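(* Let $k\in\mathbb N$, $\mathbf y\in\mathbb R^k$, $N\in\mathbb N$, $0<d\leqslant1/2$, and let $\tau>0$ be fixed. Let $\mathbf d=(d_1,\dots,d_k)\in(0,1/2]^k$ satisfy $N^{-\tau}d\ll d_j\ll N^{\tau}d$ for $1\leqslant j\leqslant k$, and for each integer $n\in[N,2N)$ let $A_n^*(\cdot)=A_n^*(\cdot;\mathbf d)$. Let $\mu$ be a Borel probability measure on $[0,1]^k$ with $\dim_{\ell^1}(\mu)=\kappa$. Then for any fixed $\varepsilon>0$, \[ \Big|\sum_{N\leqslant n<2N}\big(\mu(A_n^* )-\lambda(A_n^* )\big)\Big|\ll N^{k+(2k+\varepsilon)\tau+\varepsilon}\,d^{\kappa-\varepsilon}, \] with implied constant independent of $N$, $d$, $\mathbf d$ and $\mathbf y$.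
   Context: Let $w:\mathbb R\to[0,1]$ be a fixed non-zero smooth (Schwartz-class) bump function supported on $[-2,2]$. For $\mathbf d\in(0,1/2]^k$ put $w_{\mathcal R(\mathbf d)}(\mathbf x)=\prod_{j=1}^k w(x_j/d_j)$ and \[ A_n^*(\mathbf x;\mathbf d)=\sum_{\mathbf a\in\mathbb Z^k}w_{\mathcal R(\mathbf d)}\Big(\mathbf x-\frac{\mathbf a+\mathbf y}{n}\Big). \] $\lambda$ is Lebesgue measure on $[0,1]^k$ and $\nu(f)=\int_{[0,1]^k}f\,d\nu$. For a Borel probability measure $\nu$ on $[0,1]^k$, $\hat\nu({\boldsymbol{\xi}})=\int e^{-2\pi i{\boldsymbol{\xi}}\cdot\mathbf x}\,d\nu(\mathbf x)$ and $\dim_{\ell^1}(\nu)=\sup\{s\geqslant0:\sum_{{\boldsymbol{\xi}}\in\mathbb Z^k,\|{\boldsymbol{\xi}}\|_\infty\leqslant Q}|\hat\nu({\boldsymbol{\xi}})|\ll Q^{k-s}\ (Q\geqslant1)\}$. The implied constants in the hypotheses on $d_j$ are fixed. *)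

theory Defs
  imports "HOL-Probability.Probability"
begin

text \<open>Fixed bump function: smooth (C-infinity), values in [0,1], supported on [-2,2], non-zero.
  A compactly supported smooth function is automatically Schwartz class.\<close>
definition bump :: "(real \<Rightarrow> real) \<Rightarrow> bool" where
  "bump w \<longleftrightarrow>
     (\<exists>D :: nat \<Rightarrow> real \<Rightarrow> real. D 0 = w \<and>
        (\<forall>m x. (D m has_real_derivative D (Suc m) x) (at x))) \<and>
     (\<forall>x. 0 \<le> w x \<and> w x \<le> 1) \<and>
     (\<forall>x. \<bar>x\<bar> > 2 \<longrightarrow> w x = 0) \<and>
     (\<exists>x. w x \<noteq> 0)"

abbreviation unit_cube :: "(real^'n) set" where
  "unit_cube \<equiv> cbox 0 One"

definition A_star :: "(real \<Rightarrow> real) \<Rightarrow> real^'n \<Rightarrow> real^'n \<Rightarrow> nat \<Rightarrow> real^'n \<Rightarrow> real" where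
  "A_star w dv y n x =
     (\<Sum>\<^sub>\<infinity>a::int^'n. \<Prod>j\<in>UNIV. w ((x$j - (of_int (a$j) + y$j) / real n) / dv$j))"

definition meas_int :: "(real^'n) measure \<Rightarrow> (real^'n \<Rightarrow> real) \<Rightarrow> real" where
  "meas_int \<nu> f = (LINT x:unit_cube|\<nu>. f x)"

definition fourier_coeff :: "(real^'n) measure \<Rightarrow> int^'n \<Rightarrow> complex" where
  "fourier_coeff \<nu> \<xi> =
     (LINT x|\<nu>. cis (- 2 * pi * (\<Sum>j\<in>UNIV. of_int (\<xi>$j) * x$j)))"

definition fourier_l1_sum :: "(real^'n) measure \<Rightarrow> real \<Rightarrow> real" where
  "fourier_l1_sum \<nu> Q =
     (\<Sum>\<xi>\<in>{\<xi>::int^'n. \<forall>j. real_of_int \<bar>\<xi>$j\<bar> \<le> Q}. cmod (fourier_coeff \<nu> \<xi>))"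

definition dim_l1 :: "(real^'n) measure \<Rightarrow> real" where
  "dim_l1 \<nu> = Sup {s. s \<ge> 0 \<and>
     (\<exists>C. \<forall>Q\<ge>1. fourier_l1_sum \<nu> Q \<le> C * Q powr (real CARD('n) - s))}"

definition borel_prob_on_cube :: "(real^'n) measure \<Rightarrow> bool" where
  "borel_prob_on_cube \<mu> \<longleftrightarrow>
     prob_space \<mu> \<and> sets \<mu> = sets borel \<and> emeasure \<mu> unit_cube = 1"

end

theory Submission
  imports Defs
begin

text \<open>
  \<open>A_n^*\<close> is a product of one-dimensional periodizations of the bump, so by Poisson summation its
  Fourier series is supported on the frequencies \<open>n m\<close>, \<open>m \<in> \<int>^k\<close>, with coefficients that decay
  faster than any power beyond \<open>R = N^\<tau> / d\<close>. Integrating against \<open>\<mu> - \<lambda>\<close> removes \<open>m = 0\<close>, and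
  replaces the other characters by Fourier coefficients of \<open>\<mu>\<close>. After summing over \<open>n\<close>, a
  frequency \<open>\<xi> \<noteq> 0\<close> occurs once for every \<open>n \<in> [N, 2N)\<close> dividing it, hence \<open>O(|\<xi>|^\<eta>)\<close> times by
  the divisor bound. What remains is a smoothly truncated \<open>\<ell>^1\<close> sum of \<open>\<mu>\<close>'s Fourier coefficients
  up to height \<open>R\<close>, controlled by the \<open>\<ell>^1\<close> dimension.
\<close>

section \<open>The divisor bound\<close>

text \<open>Since \<mu> may be singular, convergence of the Fourier series in mean or
  Lebesgue-almost everywhere would not suffice. The cubic partial sums are therefore shown to
  converge at every point and to stay bounded uniformly in x; dominated convergence then serves
  \<mu> and \<lambda> alike. Bookkeeping of exponents: a coefficient of \<open>A_star\<close>
  carries the factors \<open>n * dv $ j\<close>, in total O((N^(1+\<tau>) d)^k), and the truncated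
  sum contributes R^(k-s+\<eta>), where s is an admissible exponent close to \<kappa>. The product
  is N^(k+\<tau>(2k-s+\<eta>)) d^(s-\<eta>). Thus one k\<tau> comes from the upper bound on the d_j
  and another from the lower bound, which fixes R; the saving s\<tau> is discarded. The \<epsilon>
  pays for two losses: the supremum in the dimension need not be attained, and the divisor bound
  costs \<eta>. The shift y enters the coefficients only through phases of modulus one, hence the
  uniformity in y.\<close>

lemma card_divisors_prime_power_mult:
  fixes p m a :: nat
  assumes "prime p" "m > 0"
  shows "card {d. d dvd p ^ a * m} \<le> Suc a * card {d. d dvd m}"
proof -
  have fin: "finite {d. d dvd m}"
    using \<open>m > 0\<close> by (simp add: finite_divisors_nat)
  have "{d. d dvd p ^ a * m} \<subseteq> (\<lambda>(i, e). p ^ i * e) ` ({..a} \<times> {d. d dvd m})"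
  proof
    fix d assume "d \<in> {d. d dvd p ^ a * m}"
    then obtain u v where uv: "d = u * v" "u dvd p ^ a" "v dvd m"
      using division_decomp by blast
    then obtain i where "i \<le> a" "u = p ^ i"
      using divides_primepow_nat[OF \<open>prime p\<close>] by blast
    with uv show "d \<in> (\<lambda>(i, e). p ^ i * e) ` ({..a} \<times> {d. d dvd m})"
      by (auto intro!: image_eqI[where x="(i, v)"])
  qed
  then have "card {d. d dvd p ^ a * m} \<le> card ((\<lambda>(i, e). p ^ i * e) ` ({..a} \<times> {d. d dvd m}))"
    using fin by (intro card_mono) auto
  also have "\<dots> \<le> card ({..a} \<times> {d. d dvd m})"
    using fin by (intro card_image_le) auto
  also have "\<dots> = Suc a * card {d. d dvd m}"
    by (simp add: card_cartesian_product)
  finally show ?thesis .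
qed

text \<open>Beyond the threshold \<open>p powr \<eta>\<close> is at least 2, and 2^a already
  dominates a + 1.\<close>

lemma Suc_le_powr_large:
  fixes p a :: nat and \<eta> :: real
  assumes "real p > 2 powr (1 / \<eta>)" "\<eta> > 0"
  shows "real (Suc a) \<le> real p powr (\<eta> * a)"
proof -
  have "2 = (2 powr (1 / \<eta>)) powr \<eta>"
    using \<open>\<eta> > 0\<close> by (simp add: powr_powr)
  also have "\<dots> \<le> real p powr \<eta>"
    using assms by (intro powr_mono2) auto
  finally have 2: "2 \<le> real p powr \<eta>" .
  then have "p > 0"
    by (cases "p = 0") auto
  have "real (Suc a) \<le> 2 ^ a"
    using Suc_leI[OF less_exp[of a]] by (metis of_nat_le_iff of_nat_numeral of_nat_power)
  also have "\<dots> \<le> (real p powr \<eta>) ^ a"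
    using 2 by (intro power_mono) auto
  also have "\<dots> = real p powr (\<eta> * a)"
    unfolding powr_powr[symmetric] using \<open>p > 0\<close> by (subst powr_realpow) auto
  finally show ?thesis .
qed

text \<open>Below the threshold linear growth is compared with an exponential: 1 + La is at most
  exp(La) = 2^(\<eta>a) with L = \<eta> ln 2, and the constant 1 + 1/L makes up for a small
  L.\<close>

lemma Suc_le_powr_small:
  fixes p a :: nat and \<eta> :: real
  assumes "p \<ge> 2" "\<eta> > 0"
  shows "real (Suc a) \<le> (1 + 1 / (\<eta> * ln 2)) * real p powr (\<eta> * a)"
proof -
  define L where "L = \<eta> * ln (2::real)"
  have L: "L > 0"
    using \<open>\<eta> > 0\<close> by (simp add: L_def)
  have "real (Suc a) \<le> (1 + 1 / L) * (1 + L * a)"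
    using L by (simp add: field_simps)
  also have "\<dots> \<le> (1 + 1 / L) * exp (L * a)"
    using L by (intro mult_left_mono exp_ge_add_one_self) auto
  also have "exp (L * a) = 2 powr (\<eta> * a)"
    by (simp add: powr_def L_def mult_ac)
  also have "(1 + 1 / L) * 2 powr (\<eta> * a) \<le> (1 + 1 / L) * real p powr (\<eta> * a)"
    using assms L by (intro mult_left_mono powr_mono2) auto
  finally show ?thesis
    by (simp add: L_def)
qed

text \<open>Only primes below \<open>2 powr (1 / \<eta>)\<close> contribute more than \<open>p powr (\<eta> * a)\<close> to
  the number of divisors, and each of them loses at most a constant factor.\<close>
lemma divisor_count_bound:
  fixes \<eta> :: real
  assumes "\<eta> > 0"
  shows "\<exists>C>0. \<forall>m::nat. m > 0 \<longrightarrow> real (card {d. d dvd m}) \<le> C * real m powr \<eta>"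
proof -
  define c where "c = 1 + 1 / (\<eta> * ln 2)"
  have c: "c \<ge> 1"
    using assms by (simp add: c_def)
  define S where "S = (\<lambda>m::nat. {p. prime p \<and> p dvd m \<and> real p \<le> 2 powr (1 / \<eta>)})"
  define X where "X = nat \<lceil>2 powr (1 / \<eta>)\<rceil>"
  have S_sub: "S m \<subseteq> {..X}" for m
    unfolding S_def X_def by (auto simp: le_nat_iff) linarith
  have fin_S: "finite (S m)" for m
    using S_sub finite_subset by blast
  \<comment> \<open>The exponent of \<open>c\<close> counts the small primes that divide m, not all
    of them below the threshold. Peeling off a small prime lowers the count by one, and this pays
    for the factor \<open>c\<close> it costs; a large prime costs nothing.\<close>
  have bd: "real (card {d. d dvd m}) \<le> c ^ card (S m) * real m powr \<eta>" if "m > 0" for m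
    using that
  proof (induction m rule: less_induct)
    case (less m)
    show ?case
    proof (cases "m = 1")
      case True
      then show ?thesis
        using c by simp
    next
      case False
      then obtain p where p: "prime p" "p dvd m"
        using prime_factor_nat by blast
      have "\<not> is_unit p"
        using p by auto
      then obtain m' where m': "m = p ^ multiplicity p m * m'" "\<not> p dvd m'"
        using multiplicity_decompose'[of m p] less.prems by auto
      define a where "a = multiplicity p m"
      have a: "a > 0"
        using p less.prems by (simp add: a_def prime_multiplicity_gt_zero_iff)
      have m'0: "m' > 0"
        using m' less.prems by (cases m') auto
      have p2: "p \<ge> 2"
        using p prime_ge_2_nat by blast
      have "p ^ a > 1"
        using p2 a by (intro one_less_power) auto
      then have lt: "m' < m"
        using m' m'0 by (simp flip: a_def)
      have IH: "real (card {d. d dvd m'}) \<le> c ^ card (S m') * real m' powr \<eta>"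
        using less.IH[OF lt m'0] .
      have S'_sub: "S m' \<subseteq> S m"
        using m' by (auto simp: S_def) (metis dvd_mult)
      have key: "real (Suc a) * c ^ card (S m') \<le> real p powr (\<eta> * a) * c ^ card (S m)"
      proof (cases "real p \<le> 2 powr (1 / \<eta>)")
        case True
        then have "p \<in> S m" "p \<notin> S m'"
          using p m' by (auto simp: S_def)
        then have "S m' \<subset> S m"
          using S'_sub by auto
        then have "Suc (card (S m')) \<le> card (S m)"
          using fin_S psubset_card_mono by (metis Suc_leI)
        then have "c ^ Suc (card (S m')) \<le> c ^ card (S m)"
          using c by (intro power_increasing) auto
        moreover have "real (Suc a) \<le> c * real p powr (\<eta> * a)"
          unfolding c_def by (intro Suc_le_powr_small p2 assms)
        then have "real (Suc a) * c ^ card (S m') \<le> c * real p powr (\<eta> * a) * c ^ card (S m')"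
          using c by (intro mult_right_mono) auto
        moreover have "real p powr (\<eta> * a) * c ^ Suc (card (S m')) \<le> real p powr (\<eta> * a) * c ^ card (S m)"
          using calculation(1) by (intro mult_left_mono) auto
        ultimately show ?thesis
          by (simp add: mult_ac)
      next
        case False
        have "card (S m') \<le> card (S m)"
          using S'_sub fin_S by (simp add: card_mono)
        then have "c ^ card (S m') \<le> c ^ card (S m)"
          using c by (intro power_increasing) auto
        moreover have "real (Suc a) \<le> real p powr (\<eta> * a)"
          using False assms by (intro Suc_le_powr_large) auto
        ultimately show ?thesis
          using c by (intro mult_mono) auto
      qed
      have "real (card {d. d dvd m}) \<le> real (Suc a * card {d. d dvd m'})"
        using card_divisors_prime_power_mult[OF p(1) m'0, of a] m' by (simp only: of_nat_le_iff a_def)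
      also have "\<dots> = real (Suc a) * real (card {d. d dvd m'})"
        by (simp only: of_nat_mult)
      also have "\<dots> \<le> real (Suc a) * (c ^ card (S m') * real m' powr \<eta>)"
        using IH by (intro mult_left_mono) auto
      also have "\<dots> = real (Suc a) * c ^ card (S m') * real m' powr \<eta>"
        by (simp only: mult.assoc)
      also have "\<dots> \<le> real p powr (\<eta> * a) * c ^ card (S m) * real m' powr \<eta>"
        using key by (intro mult_right_mono) auto
      also have "real p powr (\<eta> * a) = (real p ^ a) powr \<eta>"
        using p2 by (simp add: powr_powr mult.commute flip: powr_realpow)
      also have "\<dots> * c ^ card (S m) * real m' powr \<eta> = c ^ card (S m) * ((real p ^ a) * real m') powr \<eta>"
        by (subst powr_mult) auto
      also have "real p ^ a * real m' = real m"
        using m' by (metis a_def of_nat_mult of_nat_power)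
      finally show ?thesis .
    qed
  qed
  have "real (card {d. d dvd m}) \<le> c ^ Suc X * real m powr \<eta>" if "m > 0" for m
  proof -
    have "card (S m) \<le> Suc X"
      using card_mono[OF _ S_sub[of m]] by simp
    then have "c ^ card (S m) \<le> c ^ Suc X"
      using c by (intro power_increasing) auto
    then have "c ^ card (S m) * real m powr \<eta> \<le> c ^ Suc X * real m powr \<eta>"
      by (intro mult_right_mono) auto
    with bd[OF that] show ?thesis
      by linarith
  qed
  moreover have "c ^ Suc X > 0"
    using c by simp
  ultimately show ?thesis
    by blast
qed

section \<open>Poisson summation\<close>

definition unit_ivl :: "real measure" where
  "unit_ivl = restrict_space lborel {0..1}"

lemma space_unit_ivl: "space unit_ivl = {0..1}"
  by (simp add: unit_ivl_def space_restrict_space)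

lemma prob_space_unit_ivl: "prob_space unit_ivl"
  by (rule prob_spaceI) (simp add: space_unit_ivl, simp add: unit_ivl_def emeasure_restrict_space)

lemma borel_measurable_unit_ivl: "f \<in> borel_measurable borel \<Longrightarrow> f \<in> borel_measurable unit_ivl"
  by (simp add: unit_ivl_def measurable_restrict_space1)

lemma integral_unit_ivl:
  fixes f :: "real \<Rightarrow> 'a :: {banach, second_countable_topology}"
  shows "integral\<^sup>L unit_ivl f = (\<integral>t. indicator {0..1} t *\<^sub>R f t \<partial>lborel)"
  unfolding unit_ivl_def by (subst integral_restrict_space) auto

lemma integrable_unit_ivl_bounded:
  fixes f :: "real \<Rightarrow> complex"
  assumes "f \<in> borel_measurable unit_ivl" "\<And>t. t \<in> {0..1} \<Longrightarrow> cmod (f t) \<le> B"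
  shows "integrable unit_ivl f"
proof -
  interpret prob_space unit_ivl by (rule prob_space_unit_ivl)
  show ?thesis
    by (rule integrable_const_bound[of _ B]) (use assms in \<open>auto simp: space_unit_ivl\<close>)
qed

lemma borel_measurable_cis [measurable]: "cis \<in> borel_measurable borel"
  by (intro borel_measurable_continuous_onI continuous_intros)

lemma cis_2pi_int [simp]: "cis (2 * pi * of_int m) = 1"
  by (rule cis_multiple_2pi) auto

lemma has_vector_derivative_cis_linear:
  "((\<lambda>t. cis (c * t)) has_vector_derivative (\<i> * of_real c * cis (c * t))) (at t within S)"
proof -
  have "((\<lambda>z. exp (\<i> * of_real c * z)) has_field_derivative (\<i> * of_real c * exp (\<i> * of_real c * of_real t))) (at (of_real t))"
    by (auto intro!: derivative_eq_intros)
  then have "((\<lambda>t. exp (\<i> * of_real c * of_real t)) has_vector_derivative (\<i> * of_real c * exp (\<i> * of_real c * of_real t))) (at t within S)"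
    by (rule has_vector_derivative_real_field)
  then show ?thesis
    by (simp add: cis_conv_exp mult_ac)
qed

lemma integral_unit_ivl_cis:
  fixes m :: int
  shows "(\<integral>t. cis (2 * pi * m * t) \<partial>unit_ivl) = (if m = 0 then 1 else 0)"
proof (cases "m = 0")
  case True
  interpret prob_space unit_ivl by (rule prob_space_unit_ivl)
  show ?thesis
    using True by (simp add: prob_space)
next
  case False
  define c where "c = 2 * pi * real_of_int m"
  have c: "c \<noteq> 0"
    using False by (simp add: c_def)
  have "(\<integral>t. indicator {0..1} t *\<^sub>R (\<i> * of_real c * cis (c * t)) \<partial>lborel) = cis (c * 1) - cis (c * 0)"
    by (rule integral_FTC_Icc) (auto intro!: has_vector_derivative_cis_linear continuous_intros)
  also have "\<dots> = 0"
    by (simp add: c_def)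
  also have "(\<integral>t. indicator {0..1} t *\<^sub>R (\<i> * of_real c * cis (c * t)) \<partial>lborel)
    = \<i> * of_real c * (\<integral>t. indicator {0..1} t *\<^sub>R cis (c * t) \<partial>lborel)"
    by (subst integral_mult_right_zero [symmetric]) (simp add: mult_ac scaleR_conv_of_real)
  finally show ?thesis
    using c False by (simp add: integral_unit_ivl c_def)
qed

text \<open>The exponent has a plus sign, as it does in \<open>ft\<close> below: this is the usual
  coefficient at -m. The partial sums run over symmetric ranges, and the phase left by a translation
  then has the minus sign of \<open>fourier_coeff\<close>.\<close>

definition circ_coeff :: "(real \<Rightarrow> complex) \<Rightarrow> int \<Rightarrow> complex" where
  "circ_coeff h m = (\<integral>t. h t * cis (2 * pi * m * t) \<partial>unit_ivl)"

text \<open>Bessel's inequality. With \<open>s\<close> the partial sum, |h - s|^2 is nonnegative, so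
  2 Re(h cnj s) - |s|^2 is at most |h|^2 and hence at most B^2. Both integrals on the left, of h cnj
  s and of |s|^2, equal the sum of squares.\<close>

lemma circ_coeff_bessel:
  fixes h :: "real \<Rightarrow> complex"
  assumes meas: "h \<in> borel_measurable unit_ivl"
    and bd: "\<And>t. t \<in> {0..1} \<Longrightarrow> cmod (h t) \<le> B"
    and fin: "finite F"
  shows "(\<Sum>m\<in>F. (cmod (circ_coeff h m))\<^sup>2) \<le> B\<^sup>2"
proof -
  interpret prob_space unit_ivl by (rule prob_space_unit_ivl)
  note [measurable] = meas
  define e where "e = (\<lambda>(m::int) t. cis (2 * pi * m * t))"
  have e_meas [measurable]: "e m \<in> borel_measurable unit_ivl" for m
    unfolding e_def by (rule borel_measurable_unit_ivl) measurable
  have e_norm [simp]: "cmod (e m t) = 1" for m t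
    by (simp add: e_def)
  define a where "a = circ_coeff h"
  \<comment> \<open>The characters are conjugated because \<open>circ_coeff\<close> integrates
    against \<open>e\<close> itself; so \<open>s\<close> has the coefficients \<open>a\<close> on
    F.\<close>
  define s where "s = (\<lambda>t. \<Sum>m\<in>F. a m * cnj (e m t))"
  have s_meas [measurable]: "s \<in> borel_measurable unit_ivl"
    unfolding s_def by (intro borel_measurable_sum borel_measurable_times borel_measurable_const
      borel_measurable_continuous_on[OF continuous_on_cnj[OF continuous_on_id]] e_meas)
  have cnj_s: "cnj (s t) = (\<Sum>m\<in>F. cnj (a m) * e m t)" for t
    by (simp add: s_def)
  have s_bd: "cmod (s t) \<le> (\<Sum>m\<in>F. cmod (a m))" for t
    unfolding s_def by (rule order.trans[OF norm_sum]) (simp add: norm_mult)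
  have int_he: "integrable unit_ivl (\<lambda>t. h t * e m t)" for m
    by (rule integrable_unit_ivl_bounded[of _ B]) (use bd in \<open>auto simp: norm_mult\<close>)
  have cnj_meas: "(\<lambda>t. cnj (g t)) \<in> borel_measurable unit_ivl" if "g \<in> borel_measurable unit_ivl" for g
    using that by (intro borel_measurable_continuous_on[OF continuous_on_cnj[OF continuous_on_id]])
  have hs: "(\<integral>t. h t * cnj (s t) \<partial>unit_ivl) = of_real (\<Sum>m\<in>F. (cmod (a m))\<^sup>2)"
  proof -
    have "(\<integral>t. h t * cnj (s t) \<partial>unit_ivl) = (\<integral>t. (\<Sum>m\<in>F. cnj (a m) * (h t * e m t)) \<partial>unit_ivl)"
      by (simp add: cnj_s sum_distrib_left mult_ac)
    also have "\<dots> = (\<Sum>m\<in>F. cnj (a m) * (\<integral>t. h t * e m t \<partial>unit_ivl))"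
      by (subst Bochner_Integration.integral_sum) (use int_he in auto)
    also have "\<dots> = (\<Sum>m\<in>F. cnj (a m) * a m)"
      by (simp add: a_def circ_coeff_def e_def)
    also have "\<dots> = of_real (\<Sum>m\<in>F. (cmod (a m))\<^sup>2)"
      unfolding of_real_sum complex_norm_square by (simp add: mult.commute)
    finally show ?thesis .
  qed
  have ee: "(\<integral>t. cnj (e m t) * e l t \<partial>unit_ivl) = (if m = l then 1 else 0)" for m l
  proof -
    have "(\<lambda>t. cnj (e m t) * e l t) = (\<lambda>t. cis (2 * pi * of_int (l - m) * t))"
      by (simp add: e_def cis_cnj cis_mult algebra_simps)
    then show ?thesis
      using integral_unit_ivl_cis[of "l - m"] by simp
  qed
  have se: "(\<integral>t. s t * e l t \<partial>unit_ivl) = a l" if "l \<in> F" for l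
  proof -
    have "(\<integral>t. s t * e l t \<partial>unit_ivl) = (\<integral>t. (\<Sum>m\<in>F. a m * (cnj (e m t) * e l t)) \<partial>unit_ivl)"
      by (simp add: s_def sum_distrib_right mult.assoc)
    also have "\<dots> = (\<Sum>m\<in>F. a m * (\<integral>t. cnj (e m t) * e l t \<partial>unit_ivl))"
    proof (subst Bochner_Integration.integral_sum)
      fix m
      have "integrable unit_ivl (\<lambda>t. cnj (e m t) * e l t)"
        by (rule integrable_unit_ivl_bounded[of _ 1])
           (auto simp: norm_mult intro!: borel_measurable_times cnj_meas)
      then show "integrable unit_ivl (\<lambda>t. a m * (cnj (e m t) * e l t))"
        by simp
    qed simp
    also have "\<dots> = a l"
      using that fin by (simp add: ee if_distrib[of "(*) _"] cong: if_cong)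
    finally show ?thesis .
  qed
  have ss: "(\<integral>t. s t * cnj (s t) \<partial>unit_ivl) = of_real (\<Sum>m\<in>F. (cmod (a m))\<^sup>2)"
  proof -
    have "(\<integral>t. s t * cnj (s t) \<partial>unit_ivl) = (\<integral>t. (\<Sum>m\<in>F. cnj (a m) * (s t * e m t)) \<partial>unit_ivl)"
      by (simp add: cnj_s sum_distrib_left mult_ac)
    also have "\<dots> = (\<Sum>m\<in>F. cnj (a m) * (\<integral>t. s t * e m t \<partial>unit_ivl))"
    proof (subst Bochner_Integration.integral_sum)
      fix m
      have "integrable unit_ivl (\<lambda>t. s t * e m t)"
        by (rule integrable_unit_ivl_bounded[of _ "\<Sum>m\<in>F. cmod (a m)"]) (auto simp: norm_mult s_bd)
      then show "integrable unit_ivl (\<lambda>t. cnj (a m) * (s t * e m t))"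
        by simp
    qed simp
    also have "\<dots> = (\<Sum>m\<in>F. cnj (a m) * a m)"
      by (simp add: se)
    also have "\<dots> = of_real (\<Sum>m\<in>F. (cmod (a m))\<^sup>2)"
      unfolding of_real_sum complex_norm_square by (simp add: mult.commute)
    finally show ?thesis .
  qed
  have B0: "B \<ge> 0"
    using bd[of 0] norm_ge_zero[of "h 0"] by (simp del: norm_ge_zero)
  have int_hs: "integrable unit_ivl (\<lambda>t. h t * cnj (s t))"
    by (rule integrable_unit_ivl_bounded[of _ "B * (\<Sum>m\<in>F. cmod (a m))"])
       (auto simp: norm_mult intro!: mult_mono bd s_bd B0 borel_measurable_times cnj_meas)
  have int_ss: "integrable unit_ivl (\<lambda>t. s t * cnj (s t))"
    by (rule integrable_unit_ivl_bounded[of _ "(\<Sum>m\<in>F. cmod (a m)) * (\<Sum>m\<in>F. cmod (a m))"])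
       (auto simp: norm_mult intro!: mult_mono s_bd borel_measurable_times cnj_meas sum_nonneg)
  have int_re: "integrable unit_ivl (\<lambda>t. 2 * Re (h t * cnj (s t)) - Re (s t * cnj (s t)))"
    using int_hs int_ss by (intro Bochner_Integration.integrable_diff integrable_mult_right integrable_Re)
  have "(\<integral>t. 2 * Re (h t * cnj (s t)) - Re (s t * cnj (s t)) \<partial>unit_ivl)
     = 2 * Re (\<integral>t. h t * cnj (s t) \<partial>unit_ivl) - Re (\<integral>t. s t * cnj (s t) \<partial>unit_ivl)"
    using int_hs int_ss
    by (subst Bochner_Integration.integral_diff)
       (auto simp: integral_Re integrable_Re simp del: times_complex.simps complex_cnj)
  also have "\<dots> = (\<Sum>m\<in>F. (cmod (a m))\<^sup>2)"
    unfolding hs ss by simp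
  finally have "(\<Sum>m\<in>F. (cmod (a m))\<^sup>2) = (\<integral>t. 2 * Re (h t * cnj (s t)) - Re (s t * cnj (s t)) \<partial>unit_ivl)"
    by simp
  also have "\<dots> \<le> (\<integral>t. B\<^sup>2 \<partial>unit_ivl)"
  proof (rule integral_mono[OF int_re])
    fix t assume "t \<in> space unit_ivl"
    then have "cmod (h t) \<le> B"
      using bd by (simp add: space_unit_ivl)
    then have "(cmod (h t))\<^sup>2 \<le> B\<^sup>2"
      by (intro power_mono) auto
    moreover have "(cmod (h t))\<^sup>2 - (2 * Re (h t * cnj (s t)) - Re (s t * cnj (s t)))
        = (Re (h t) - Re (s t))\<^sup>2 + (Im (h t) - Im (s t))\<^sup>2"
      unfolding cmod_power2 by (simp add: power2_eq_square algebra_simps)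
    then have "2 * Re (h t * cnj (s t)) - Re (s t * cnj (s t)) \<le> (cmod (h t))\<^sup>2"
      by (smt (verit) zero_le_power2)
    ultimately show "2 * Re (h t * cnj (s t)) - Re (s t * cnj (s t)) \<le> B\<^sup>2"
      by linarith
  qed simp
  also have "\<dots> = B\<^sup>2"
    by (simp add: prob_space)
  finally show ?thesis
    by (simp add: a_def)
qed

text \<open>Riemann-Lebesgue for bounded functions: by Bessel the squares along distinct frequencies
  are summable. An injective sequence covers both ends of the frequency line, -M and M + 1 in the
  application.\<close>

lemma circ_coeff_tendsto_zero:
  fixes h :: "real \<Rightarrow> complex" and g :: "nat \<Rightarrow> int"
  assumes meas: "h \<in> borel_measurable unit_ivl"
    and bd: "\<And>t. t \<in> {0..1} \<Longrightarrow> cmod (h t) \<le> B"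
    and inj: "inj g"
  shows "(\<lambda>n. circ_coeff h (g n)) \<longlonglongrightarrow> 0"
proof -
  have "summable (\<lambda>n. (cmod (circ_coeff h (g n)))\<^sup>2)"
  proof (rule summableI_nonneg_bounded[where x="B\<^sup>2"])
    fix n
    have "(\<Sum>i<n. (cmod (circ_coeff h (g i)))\<^sup>2) = (\<Sum>m\<in>g ` {..<n}. (cmod (circ_coeff h m))\<^sup>2)"
      using inj by (subst sum.reindex) (auto intro: inj_on_subset)
    also have "\<dots> \<le> B\<^sup>2"
      using meas bd by (rule circ_coeff_bessel) auto
    finally show "(\<Sum>i<n. (cmod (circ_coeff h (g i)))\<^sup>2) \<le> B\<^sup>2" .
  qed auto
  then have "(\<lambda>n. (cmod (circ_coeff h (g n)))\<^sup>2) \<longlonglongrightarrow> 0"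
    by (rule summable_LIMSEQ_zero)
  then have "(\<lambda>n. sqrt ((cmod (circ_coeff h (g n)))\<^sup>2)) \<longlonglongrightarrow> sqrt 0"
    by (rule tendsto_real_sqrt)
  then show ?thesis
    by (simp add: tendsto_norm_zero_iff)
qed

section \<open>Pointwise convergence of Fourier series\<close>

text \<open>The cubic error x^3/6 is at most 2x/3 on [0,2]. The range contains [0, pi/2], and the
  loss of a factor 3 is made good by pi > 3 when x = pi u.\<close>

lemma sin_ge_third:
  fixes x :: real
  assumes "0 \<le> x" "x \<le> 2"
  shows "sin x \<ge> x / 3"
proof -
  have "\<bar>sin x - (\<Sum>m<3. sin_coeff m * x ^ m)\<bar> \<le> inverse (fact 3) * \<bar>x\<bar> ^ 3"
    by (rule Maclaurin_sin_bound)
  then have "\<bar>sin x - x\<bar> \<le> x ^ 3 / 6"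
    using assms by (simp add: eval_nat_numeral sin_coeff_def)
  moreover have "x * x \<le> 2 * 2"
    using assms by (intro mult_mono) auto
  then have "x * (x * x) \<le> x * 4"
    using assms by (intro mult_left_mono) auto
  then have "x ^ 3 \<le> 4 * x"
    by (simp add: power3_eq_cube mult_ac)
  ultimately show ?thesis
    by linarith
qed

text \<open>The modulus is 2 |sin(pi t)|, and the symmetry of t and 1 - t reduces to the half
  interval. This bounds the denominator in Chernoff's quotient from below by the distance to the
  nearest integer.\<close>

lemma norm_one_minus_cis_ge:
  fixes t :: real
  assumes "0 \<le> t" "t \<le> 1"
  shows "cmod (1 - cis (2 * pi * t)) \<ge> min t (1 - t)"
proof -
  have half: "sin (pi * u) \<ge> u" if "0 \<le> u" "u \<le> 1/2" for u
  proof -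
    have "pi * u \<le> 4 * (1/2)"
      using that pi_less_4 by (intro mult_mono) auto
    then have "sin (pi * u) \<ge> pi * u / 3"
      using that by (intro sin_ge_third) auto
    moreover have "3 * u \<le> pi * u"
      using that pi_gt3 by (intro mult_right_mono) auto
    ultimately show ?thesis
      by linarith
  qed
  have "sin (pi * t) \<ge> min t (1 - t)"
  proof (cases "t \<le> 1/2")
    case True
    then show ?thesis
      using half[of t] assms by auto
  next
    case False
    have "sin (pi * (1 - t)) = sin (pi * t)"
      by (simp add: right_diff_distrib)
    then show ?thesis
      using half[of "1 - t"] assms False by auto
  qed
  moreover have "(cmod (1 - cis (2 * pi * t)))\<^sup>2 = (2 * sin (pi * t))\<^sup>2"
  proof -
    have "(cmod (1 - cis (2 * pi * t)))\<^sup>2 = (1 - cos (2 * (pi * t)))\<^sup>2 + (sin (2 * (pi * t)))\<^sup>2"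
      by (simp add: cmod_power2 mult.assoc)
    also have "\<dots> = 2 - 2 * cos (2 * (pi * t))"
      using sin_cos_squared_add[of "2 * (pi * t)"] by (simp add: power2_eq_square algebra_simps)
    also have "\<dots> = (2 * sin (pi * t))\<^sup>2"
      by (simp add: cos_double_sin power_mult_distrib)
    finally show ?thesis .
  qed
  then have "cmod (1 - cis (2 * pi * t)) = \<bar>2 * sin (pi * t)\<bar>"
    by (metis abs_norm_cancel power2_eq_iff_nonneg abs_ge_zero power2_abs norm_ge_zero)
  ultimately show ?thesis
    using assms by (auto simp: min_def split: if_splits)
qed

text \<open>Chernoff's argument: the coefficients of \<open>F - F 0 = h * (1 - e)\<close> are differences of
  consecutive coefficients of the bounded function \<open>h\<close>, so the partial sums telescope.\<close>
lemma fourier_series_at_zero: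
  fixes F :: "real \<Rightarrow> complex"
  assumes meas: "F \<in> borel_measurable borel"
    and left: "\<And>t. t \<in> {0..1} \<Longrightarrow> cmod (F t - F 0) \<le> K * t"
    and right: "\<And>t. t \<in> {0..1} \<Longrightarrow> cmod (F t - F 0) \<le> K * (1 - t)"
  shows "(\<lambda>M::nat. \<Sum>m\<in>{- int M..int M}. circ_coeff F m) \<longlonglongrightarrow> F 0"
proof -
  interpret prob_space unit_ivl by (rule prob_space_unit_ivl)
  \<comment> \<open>At t = 0 and t = 1 the denominator is 0, so \<open>h\<close> takes the value 0
    there. The factorization of F - F 0 survives at these points because the two hypotheses force
    \<open>F 1 = F 0\<close>.\<close>
  define h where "h = (\<lambda>t. (F t - F 0) / (1 - cis (2 * pi * t)))"
  have K: "K \<ge> 0"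
    using order.trans[OF norm_ge_zero left[of 1]] by simp
  have h_bd: "cmod (h t) \<le> K" if "t \<in> {0..1}" for t
  proof (cases "t = 0 \<or> t = 1")
    case True
    then show ?thesis
      using K by (auto simp: h_def)
  next
    case False
    then have pos: "0 < min t (1 - t)"
      using that by auto
    have "cmod (F t - F 0) \<le> K * min t (1 - t)"
      using left[OF that] right[OF that] by (auto simp: min_def)
    moreover have "min t (1 - t) \<le> cmod (1 - cis (2 * pi * t))"
      using that by (intro norm_one_minus_cis_ge) auto
    ultimately have "cmod (F t - F 0) / cmod (1 - cis (2 * pi * t)) \<le> (K * min t (1 - t)) / min t (1 - t)"
      using pos K by (intro frac_le) auto
    then show ?thesis
      using pos by (simp add: h_def norm_divide)
  qed
  have h_eq: "F t = h t * (1 - cis (2 * pi * t)) + F 0" if "t \<in> {0..1}" for t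
  proof (cases "t = 0 \<or> t = 1")
    case True
    then show ?thesis
      using left[of 0] right[of 1] by auto
  next
    case False
    then have pos: "0 < min t (1 - t)"
      using that by auto
    then have "1 - cis (2 * pi * t) \<noteq> 0"
      using norm_one_minus_cis_ge[of t] that by auto
    then show ?thesis
      by (simp add: h_def)
  qed
  have h_meas: "h \<in> borel_measurable unit_ivl"
    unfolding h_def
    by (intro borel_measurable_unit_ivl borel_measurable_divide borel_measurable_diff meas
        borel_measurable_const borel_measurable_continuous_onI continuous_intros)
  note [measurable] = h_meas
  have e_meas [measurable]: "(\<lambda>t. cis (2 * pi * real_of_int m * t)) \<in> borel_measurable unit_ivl" for m
    by (rule borel_measurable_unit_ivl) measurable
  have int_h: "integrable unit_ivl (\<lambda>t. h t * cis (2 * pi * real_of_int m * t))" for m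
    by (rule integrable_unit_ivl_bounded[of _ K]) (use h_bd in \<open>auto simp: norm_mult\<close>)
  have int_e: "integrable unit_ivl (\<lambda>t. cis (2 * pi * real_of_int m * t))" for m
    by (rule integrable_unit_ivl_bounded[of _ 1]) auto
  have coeff: "circ_coeff F m = circ_coeff h m - circ_coeff h (m + 1) + (if m = 0 then F 0 else 0)" for m
  proof -
    have "circ_coeff F m = (\<integral>t. h t * cis (2 * pi * m * t) - h t * cis (2 * pi * of_int (m + 1) * t)
                                  + F 0 * cis (2 * pi * m * t) \<partial>unit_ivl)"
      unfolding circ_coeff_def
    proof (rule Bochner_Integration.integral_cong)
      fix t assume "t \<in> space unit_ivl"
      then have t: "t \<in> {0..1}"
        by (simp add: space_unit_ivl)
      have "cis (2 * pi * of_int (m + 1) * t) = cis (2 * pi * t) * cis (2 * pi * m * t)"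
        by (simp add: cis_mult algebra_simps)
      then show "F t * cis (2 * pi * m * t) = h t * cis (2 * pi * m * t) - h t * cis (2 * pi * of_int (m + 1) * t)
                                  + F 0 * cis (2 * pi * m * t)"
        by (subst h_eq[OF t]) (simp add: algebra_simps)
    qed simp
    also have "\<dots> = circ_coeff h m - circ_coeff h (m + 1) + F 0 * (\<integral>t. cis (2 * pi * m * t) \<partial>unit_ivl)"
      unfolding circ_coeff_def
      by (subst Bochner_Integration.integral_add Bochner_Integration.integral_diff;
          (intro Bochner_Integration.integrable_diff integrable_mult_right int_h int_e)?)+ simp
    finally show ?thesis
      by (simp add: integral_unit_ivl_cis)
  qed
  have tele: "(\<Sum>m\<in>{- int M..int M}. circ_coeff F m) = circ_coeff h (- int M) - circ_coeff h (int M + 1) + F 0" for M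
  proof -
    have "(\<Sum>m\<in>{- int M..int M}. circ_coeff h m - circ_coeff h (m + 1))
            = circ_coeff h (- int M) - circ_coeff h (int M + 1)"
    proof (induction M)
      case (Suc M)
      have "{- int (Suc M)..int (Suc M)} = insert (- int (Suc M)) (insert (int (Suc M)) {- int M..int M})"
        by auto
      then show ?case
        using Suc by (simp add: algebra_simps)
    qed simp
    then show ?thesis
      by (simp add: coeff sum.distrib)
  qed
  have "(\<lambda>M. circ_coeff h (- int M) - circ_coeff h (int M + 1) + F 0) \<longlonglongrightarrow> 0 - 0 + F 0"
    by (intro tendsto_add tendsto_diff tendsto_const circ_coeff_tendsto_zero[OF h_meas h_bd])
       (auto simp: inj_def)
  then show ?thesis
    by (simp add: tele)
qed

section \<open>Periodization and the Poisson formula\<close>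

definition ft :: "(real \<Rightarrow> complex) \<Rightarrow> real \<Rightarrow> complex" where
  "ft f \<xi> = (\<integral>t. f t * cis (2 * pi * \<xi> * t) \<partial>lborel)"

lemma integrable_compact_support:
  fixes f :: "real \<Rightarrow> complex"
  assumes cont: "continuous_on UNIV f" and supp: "\<And>t. \<bar>t\<bar> > B \<Longrightarrow> f t = 0"
  shows "integrable lborel f"
proof -
  have "integrable lborel (\<lambda>t. indicator {- B..B} t *\<^sub>R f t)"
    by (rule borel_integrable_compact) (auto intro: continuous_on_subset[OF cont])
  also have "(\<lambda>t. indicator {- B..B} t *\<^sub>R f t) = f"
    using supp by (fastforce simp: indicator_def)
  finally show ?thesis .
qed

lemma AE_lborel_not_Ints: "AE t in lborel. t \<notin> (\<int> :: real set)"
proof -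
  have "countable (\<int> :: real set)"
    by (simp add: Ints_def)
  then have "(\<int> :: real set) \<in> null_sets lborel"
    by (rule countable_imp_null_set_lborel)
  then show ?thesis
    by (rule AE_not_in)
qed

text \<open>The line is cut into the intervals [a, a+1], each moved to [0,1]; a character of integer
  frequency does not notice the shift. As L exceeds the support radius B, finitely many intervals
  suffice.\<close>

lemma ft_eq_circ_coeff_periodization:
  fixes f :: "real \<Rightarrow> complex" and L m :: int
  assumes cont: "continuous_on UNIV f" and supp: "\<And>t. \<bar>t\<bar> > B \<Longrightarrow> f t = 0" and L: "B < real_of_int L"
  shows "ft f m = circ_coeff (\<lambda>t. \<Sum>a\<in>{- L..L}. f (t + of_int a)) m"
proof -
  define e where "e = (\<lambda>t. cis (2 * pi * of_int m * t))"
  define g where "g = (\<lambda>t. f t * e t)"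
  have e_period: "e (t + of_int a) = e t" for t and a :: int
  proof -
    have "e (t + of_int a) = e t * cis (2 * pi * of_int (m * a))"
      by (simp add: e_def cis_mult algebra_simps del: cis_2pi_int)
    then show ?thesis
      by (simp only: cis_2pi_int mult_1_right)
  qed
  have g_cont: "continuous_on S g" for S
    unfolding g_def e_def by (intro continuous_intros continuous_on_subset[OF cont]) auto
  have g_int: "integrable lborel (\<lambda>t. indicator {of_int a..of_int a + 1} t *\<^sub>R g t)" for a :: int
    by (rule borel_integrable_compact) (auto intro: g_cont)
  have shift: "(\<integral>t. indicator {of_int a..of_int a + 1} t *\<^sub>R g t \<partial>lborel)
      = (\<integral>t. f (t + of_int a) * e t \<partial>unit_ivl)" for a :: int
  proof -
    have "(\<integral>t. indicator {of_int a..of_int a + 1} t *\<^sub>R g t \<partial>lborel)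
      = (\<integral>t. indicator {of_int a..of_int a + 1} (of_int a + 1 * t) *\<^sub>R g (of_int a + 1 * t) \<partial>lborel)"
      by (subst lborel_integral_real_affine[where c=1 and t="of_int a"]) auto
    also have "\<dots> = (\<integral>t. indicator {0..1} t *\<^sub>R (f (t + of_int a) * e t) \<partial>lborel)"
      by (intro Bochner_Integration.integral_cong)
         (auto simp: indicator_def g_def e_period add.commute[of "of_int a"])
    finally show ?thesis
      by (simp add: integral_unit_ivl)
  qed
  have "ft f m = (\<integral>t. g t \<partial>lborel)"
    by (simp add: ft_def g_def e_def)
  also have "\<dots> = (\<integral>t. (\<Sum>a\<in>{- L..L}. indicator {of_int a..of_int a + 1} t *\<^sub>R g t) \<partial>lborel)"
  proof (rule integral_cong_AE)
    show "g \<in> borel_measurable lborel"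
      using borel_measurable_continuous_onI[OF g_cont] by simp
    show "(\<lambda>t. \<Sum>a\<in>{- L..L}. indicator {of_int a..of_int a + 1} t *\<^sub>R g t) \<in> borel_measurable lborel"
      using g_int by (intro borel_measurable_sum) auto
    \<comment> \<open>The closed intervals overlap at the integers, where the sum would count g
      twice; these form a null set. Elsewhere only a = \<lfloor>t\<rfloor> contributes.\<close>
    show "AE t in lborel. g t = (\<Sum>a\<in>{- L..L}. indicator {of_int a..of_int a + 1} t *\<^sub>R g t)"
      using AE_lborel_not_Ints
    proof eventually_elim
      case (elim t)
      show ?case
      proof (cases "\<bar>t\<bar> > B")
        case True
        then show ?thesis
          using supp by (simp add: g_def)
      next
        case False
        have one: "indicator {real_of_int a..real_of_int a + 1} t = (if a = \<lfloor>t\<rfloor> then 1 else 0 :: real)" for a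
        proof (cases "a = \<lfloor>t\<rfloor>")
          case True
          then show ?thesis
            by (auto simp: indicator_def intro: less_imp_le)
        next
          case False
          have "t \<noteq> of_int (a + 1)"
            using elim by auto
          then have "t \<notin> {real_of_int a..real_of_int a + 1}"
            using False floor_unique[of a t] by auto
          then show ?thesis
            using False by simp
        qed
        have "\<lfloor>t\<rfloor> \<in> {- L..L}"
          using False L by (auto simp: le_floor_iff floor_le_iff)
        then show ?thesis
          by (simp add: one if_distrib[of "\<lambda>x. x *\<^sub>R _"] cong: if_cong)
      qed
    qed
  qed
  also have "\<dots> = (\<Sum>a\<in>{- L..L}. \<integral>t. f (t + of_int a) * e t \<partial>unit_ivl)"
    by (subst Bochner_Integration.integral_sum) (use g_int shift in auto)
  also have "\<dots> = (\<integral>t. (\<Sum>a\<in>{- L..L}. f (t + of_int a) * e t) \<partial>unit_ivl)"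
  proof (rule Bochner_Integration.integral_sum [symmetric])
    fix a
    have "continuous_on {0..1} (\<lambda>t. f (t + of_int a) * e t)"
      unfolding e_def by (intro continuous_intros continuous_on_compose2[OF cont]) auto
    then have "set_integrable lborel {0..1} (\<lambda>t. f (t + of_int a) * e t)"
      by (rule borel_integrable_atLeastAtMost')
    then show "integrable unit_ivl (\<lambda>t. f (t + of_int a) * e t)"
      unfolding unit_ivl_def set_integrable_def by (subst integrable_restrict_space) auto
  qed
  also have "\<dots> = circ_coeff (\<lambda>t. \<Sum>a\<in>{- L..L}. f (t + of_int a)) m"
    by (simp add: circ_coeff_def e_def sum_distrib_right)
  finally show ?thesis .
qed

text \<open>The truncated periodization \<open>G\<close> is again Lipschitz, and it takes the same
  value at 0 and at 1. This gives the two one-sided bounds that the convergence result at 0 asks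
  for.\<close>

lemma poisson_summation_zero:
  fixes f :: "real \<Rightarrow> complex" and L :: int
  assumes lip: "\<And>s t. cmod (f s - f t) \<le> K * \<bar>s - t\<bar>"
    and supp: "\<And>t. \<bar>t\<bar> > B \<Longrightarrow> f t = 0" and L: "B < real_of_int L" "0 \<le> L"
  shows "(\<lambda>M::nat. \<Sum>m\<in>{- int M..int M}. ft f (of_int m)) \<longlonglongrightarrow> (\<Sum>a\<in>{- L..L}. f (of_int a))"
proof -
  define G where "G = (\<lambda>t. \<Sum>a\<in>{- L..L}. f (t + of_int a))"
  have K0: "K \<ge> 0"
    using order.trans[OF norm_ge_zero lip[of 0 1]] by simp
  have cont: "continuous_on UNIV f"
    by (rule lipschitz_on_continuous_on[of K])
       (rule lipschitz_onI, use lip K0 in \<open>auto simp: dist_norm\<close>)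
  have G_lip: "cmod (G s - G t) \<le> (of_int (2 * L + 1) * K) * \<bar>s - t\<bar>" for s t
  proof -
    have "cmod (G s - G t) = cmod (\<Sum>a\<in>{- L..L}. f (s + of_int a) - f (t + of_int a))"
      by (simp add: G_def sum_subtractf)
    also have "\<dots> \<le> (\<Sum>a\<in>{- L..L}. cmod (f (s + of_int a) - f (t + of_int a)))"
      by (rule norm_sum)
    also have "\<dots> \<le> (\<Sum>a\<in>{- L..L}. K * \<bar>s - t\<bar>)"
    proof (intro sum_mono)
      fix a
      show "cmod (f (s + of_int a) - f (t + of_int a)) \<le> K * \<bar>s - t\<bar>"
        using lip[of "s + of_int a" "t + of_int a"] by simp
    qed
    also have "\<dots> = (of_int (2 * L + 1) * K) * \<bar>s - t\<bar>"
      using L by simp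
    finally show ?thesis .
  qed
  \<comment> \<open>Moving the window by one drops the term at -L and adds the one at L + 1; both
    lie outside the support.\<close>
  have "G 1 = (\<Sum>a\<in>{- L + 1..L + 1}. f (of_int a))"
    unfolding G_def
    by (rule sum.reindex_bij_witness[where i="\<lambda>a. a - 1" and j="\<lambda>a. a + 1"]) (auto simp: add.commute)
  also have "\<dots> = (\<Sum>a\<in>{- L..L}. f (of_int a))"
  proof (rule sum.mono_neutral_cong)
    fix i assume "i \<in> {- L..L} - {- L + 1..L + 1}"
    then have "i = - L"
      by auto
    then show "f (of_int i) = 0"
      using L by (intro supp) auto
  next
    fix i assume "i \<in> {- L + 1..L + 1} - {- L..L}"
    then have "i = L + 1"
      by auto
    then show "f (of_int i) = 0"
      using L by (intro supp) auto
  qed auto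
  finally have G1: "G 1 = G 0"
    by (simp add: G_def)
  have "(\<lambda>M::nat. \<Sum>m\<in>{- int M..int M}. circ_coeff G m) \<longlonglongrightarrow> G 0"
  proof (rule fourier_series_at_zero)
    have "continuous_on UNIV G"
      unfolding G_def by (intro continuous_intros continuous_on_compose2[OF cont]) auto
    then show "G \<in> borel_measurable borel"
      by (rule borel_measurable_continuous_onI)
    show "cmod (G t - G 0) \<le> (of_int (2 * L + 1) * K) * t" if "t \<in> {0..1}" for t
      using G_lip[of t 0] that by simp
    show "cmod (G t - G 0) \<le> (of_int (2 * L + 1) * K) * (1 - t)" if "t \<in> {0..1}" for t
      using G_lip[of t 1] that by (simp add: G1)
  qed
  moreover have "circ_coeff G m = ft f (of_int m)" for m
    unfolding G_def by (rule ft_eq_circ_coeff_periodization[symmetric]) (use cont supp L in auto)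
  ultimately show ?thesis
    by (simp add: G_def)
qed

lemma ft_translate: "ft (\<lambda>t. f (t + u)) \<xi> = ft f \<xi> * cis (- 2 * pi * \<xi> * u)"
proof -
  have "ft f \<xi> = (\<integral>t. f (u + 1 * t) * cis (2 * pi * \<xi> * (u + 1 * t)) \<partial>lborel)"
    unfolding ft_def by (subst lborel_integral_real_affine[where c=1 and t=u]) auto
  also have "\<dots> = (\<integral>t. cis (2 * pi * \<xi> * u) * (f (t + u) * cis (2 * pi * \<xi> * t)) \<partial>lborel)"
    by (intro Bochner_Integration.integral_cong) (auto simp: cis_mult algebra_simps)
  also have "\<dots> = cis (2 * pi * \<xi> * u) * ft (\<lambda>t. f (t + u)) \<xi>"
    unfolding ft_def by (rule integral_mult_right_zero)
  finally have "ft f \<xi> * cis (- 2 * pi * \<xi> * u)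
      = (cis (2 * pi * \<xi> * u) * cis (- 2 * pi * \<xi> * u)) * ft (\<lambda>t. f (t + u)) \<xi>"
    by simp
  then show ?thesis
    by (simp add: cis_mult)
qed

lemma ft_dilate:
  assumes "\<delta> > 0"
  shows "ft (\<lambda>t. f (t / \<delta>)) \<xi> = of_real \<delta> * ft f (\<delta> * \<xi>)"
proof -
  have "ft (\<lambda>t. f (t / \<delta>)) \<xi> = \<bar>\<delta>\<bar> *\<^sub>R (\<integral>t. f ((0 + \<delta> * t) / \<delta>) * cis (2 * pi * \<xi> * (0 + \<delta> * t)) \<partial>lborel)"
    unfolding ft_def using assms by (subst lborel_integral_real_affine[where c=\<delta> and t=0]) auto
  then show ?thesis
    using assms by (simp add: ft_def scaleR_conv_of_real mult_ac)
qed

text \<open>The case u = 0 applied to a translate, whose support radius grows by |u|. The reflection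
  of a yields the arguments u - a that occur in \<open>A_star\<close>.\<close>

lemma poisson_summation:
  fixes f :: "real \<Rightarrow> complex" and L :: int
  assumes lip: "\<And>s t. cmod (f s - f t) \<le> K * \<bar>s - t\<bar>"
    and supp: "\<And>t. \<bar>t\<bar> > B \<Longrightarrow> f t = 0" and L: "B + \<bar>u\<bar> < real_of_int L" "0 \<le> L"
  shows "(\<lambda>M::nat. \<Sum>m\<in>{- int M..int M}. ft f (of_int m) * cis (- 2 * pi * of_int m * u))
           \<longlonglongrightarrow> (\<Sum>a\<in>{- L..L}. f (u - of_int a))"
proof -
  have "(\<lambda>M::nat. \<Sum>m\<in>{- int M..int M}. ft (\<lambda>t. f (t + u)) (of_int m)) \<longlonglongrightarrow> (\<Sum>a\<in>{- L..L}. f (of_int a + u))"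
  proof (rule poisson_summation_zero)
    show "cmod (f (s + u) - f (t + u)) \<le> K * \<bar>s - t\<bar>" for s t
      using lip[of "s + u" "t + u"] by simp
    show "f (t + u) = 0" if "\<bar>t\<bar> > B + \<bar>u\<bar>" for t
      using that by (intro supp) linarith
  qed (use L in auto)
  also have "(\<Sum>a\<in>{- L..L}. f (of_int a + u)) = (\<Sum>a\<in>{- L..L}. f (u - of_int a))"
    by (rule sum.reindex_bij_witness[where i=uminus and j=uminus]) (auto simp: add.commute)
  finally show ?thesis
    by (simp add: ft_translate)
qed

section \<open>Decay of the Fourier transform of a bump\<close>

text \<open>Integration by parts, obtained by integrating the derivative of f times the character
  over an interval at whose ends f vanishes. The minus sign reflects the plus sign in
  \<open>ft\<close>.\<close>

lemma ft_derivative: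
  fixes f f' :: "real \<Rightarrow> real"
  assumes deriv: "\<And>t. (f has_real_derivative f' t) (at t)"
    and cont': "continuous_on UNIV f'"
    and supp: "\<And>t. \<bar>t\<bar> > B \<Longrightarrow> f t = 0" and supp': "\<And>t. \<bar>t\<bar> > B \<Longrightarrow> f' t = 0"
  shows "ft (\<lambda>t. of_real (f' t)) \<xi> = - (2 * pi * \<i> * \<xi>) * ft (\<lambda>t. of_real (f t)) \<xi>"
proof -
  define c where "c = 2 * pi * \<xi>"
  \<comment> \<open>The absolute value and the added 1 make [-B', B'] a genuine interval for every
    sign of B, with endpoints strictly outside the support radius.\<close>
  define B' where "B' = \<bar>B\<bar> + 1"
  have cont: "continuous_on UNIV f"
    using deriv by (auto intro!: continuous_at_imp_continuous_on DERIV_isCont)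
  have cont_c: "continuous_on S (\<lambda>t. complex_of_real (f t))" "continuous_on S (\<lambda>t. complex_of_real (f' t))" for S
    by (intro continuous_intros continuous_on_subset[OF cont] continuous_on_subset[OF cont'], auto)+
  define g where "g = (\<lambda>t. of_real (f t) * (\<i> * of_real c * cis (c * t)) + of_real (f' t) * cis (c * t))"
  have int1: "integrable lborel (\<lambda>t. of_real (f t) * cis (c * t))"
    by (rule integrable_compact_support[where B=B]) (use supp in \<open>auto intro!: continuous_intros cont_c\<close>)
  have int2: "integrable lborel (\<lambda>t. of_real (f' t) * cis (c * t))"
    by (rule integrable_compact_support[where B=B]) (use supp' in \<open>auto intro!: continuous_intros cont_c\<close>)
  have "(\<integral>t. g t \<partial>lborel) = (\<integral>t. indicator {- B'..B'} t *\<^sub>R g t \<partial>lborel)"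
    by (intro Bochner_Integration.integral_cong)
       (auto simp: g_def indicator_def B'_def supp supp' not_le)
  also have "\<dots> = of_real (f B') * cis (c * B') - of_real (f (- B')) * cis (c * (- B'))"
  proof (rule integral_FTC_Icc)
    show "continuous_on {- B'..B'} g"
      unfolding g_def by (intro continuous_intros cont_c)
    fix x
    have "((\<lambda>t. complex_of_real (f t)) has_vector_derivative of_real (f' x)) (at x within {- B'..B'})"
      using deriv[of x] by (intro has_vector_derivative_of_real)
        (auto simp: has_real_derivative_iff_has_vector_derivative intro: has_vector_derivative_at_within)
    from has_vector_derivative_mult[OF this has_vector_derivative_cis_linear[of c x]]
    show "((\<lambda>t. of_real (f t) * cis (c * t)) has_vector_derivative g x) (at x within {- B'..B'})"
      by (simp add: g_def)
  qed (simp add: B'_def)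
  also have "\<dots> = 0"
    using supp[of B'] supp[of "- B'"] by (simp add: B'_def)
  finally have "0 = (\<integral>t. g t \<partial>lborel)"
    by simp
  also have "\<dots> = (\<integral>t. \<i> * of_real c * (of_real (f t) * cis (c * t)) + of_real (f' t) * cis (c * t) \<partial>lborel)"
    by (simp add: g_def mult_ac)
  also have "\<dots> = \<i> * of_real c * ft (\<lambda>t. of_real (f t)) \<xi> + ft (\<lambda>t. of_real (f' t)) \<xi>"
    using int1 int2 by (subst Bochner_Integration.integral_add) (auto simp: ft_def c_def)
  finally show ?thesis
    by (simp add: c_def add_eq_0_iff algebra_simps)
qed

lemma derivative_zero_outside_support:
  fixes f f' :: "real \<Rightarrow> real"
  assumes deriv: "\<And>t. (f has_real_derivative f' t) (at t)"
    and supp: "\<And>t. \<bar>t\<bar> > B \<Longrightarrow> f t = 0" and t: "\<bar>t\<bar> > B"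
  shows "f' t = 0"
proof -
  have op: "open {t::real. \<bar>t\<bar> > B}"
    by (intro open_Collect_less continuous_intros)
  have "((\<lambda>_. 0) has_real_derivative 0) (at t)"
    by simp
  then have "(f has_real_derivative 0) (at t)"
    by (rule has_field_derivative_transform_within_open[OF _ op]) (use t in \<open>auto simp: supp\<close>)
  with deriv[of t] show ?thesis
    by (rule DERIV_unique)
qed

lemma norm_ft_le: "cmod (ft f \<xi>) \<le> (\<integral>t. cmod (f t) \<partial>lborel)"
  unfolding ft_def by (rule order.trans[OF integral_norm_bound]) (simp add: norm_mult)

text \<open>P integrations by parts bound |\<xi>|^P times the transform by the L1 norm of the P-th
  derivative, which settles large \<xi>. The L1 norm of \<open>w\<close> settles small
  \<xi>.\<close>

lemma bump_ft_decay:
  fixes P :: nat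
  assumes "bump w"
  shows "\<exists>K>0. \<forall>\<xi>. cmod (ft (\<lambda>t. of_real (w t)) \<xi>) \<le> K / (1 + \<bar>\<xi>\<bar>) ^ P"
proof -
  obtain D :: "nat \<Rightarrow> real \<Rightarrow> real" where D0: "D 0 = w"
    and D: "\<And>m x. (D m has_real_derivative D (Suc m) x) (at x)"
    using assms unfolding bump_def by blast
  have supp: "D m t = 0" if "\<bar>t\<bar> > 2" for m t
    using that
  proof (induction m arbitrary: t)
    case 0
    then show ?case
      using assms by (simp add: D0 bump_def)
  next
    case (Suc m)
    show ?case
      using D[of m] Suc.IH Suc.prems by (rule derivative_zero_outside_support)
  qed
  have cont: "continuous_on UNIV (D m)" for m
    using D by (auto intro!: continuous_at_imp_continuous_on DERIV_isCont)
  define W where "W = ft (\<lambda>t. of_real (w t))"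
  have power: "ft (\<lambda>t. of_real (D m t)) \<xi> = (- (2 * pi * \<i> * \<xi>)) ^ m * W \<xi>" for m \<xi>
  proof (induction m)
    case (Suc m)
    have "ft (\<lambda>t. of_real (D (Suc m) t)) \<xi> = - (2 * pi * \<i> * \<xi>) * ft (\<lambda>t. of_real (D m t)) \<xi>"
      by (rule ft_derivative[where B=2]) (use D cont supp in auto)
    then show ?case
      using Suc by simp
  qed (simp add: D0 W_def)
  define I where "I = (\<lambda>m. \<integral>t. cmod (of_real (D m t)) \<partial>lborel)"
  have I0: "I m \<ge> 0" for m
    by (simp add: I_def)
  have b0: "cmod (W \<xi>) \<le> I 0" for \<xi>
    unfolding W_def I_def D0 by (rule norm_ft_le)
  have bP: "\<bar>\<xi>\<bar> ^ P * cmod (W \<xi>) \<le> I P" for \<xi>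
  proof -
    have "\<bar>\<xi>\<bar> ^ P \<le> (2 * pi * \<bar>\<xi>\<bar>) ^ P"
    proof (intro power_mono)
      have "1 * \<bar>\<xi>\<bar> \<le> (2 * pi) * \<bar>\<xi>\<bar>"
        using pi_gt3 by (intro mult_right_mono) auto
      then show "\<bar>\<xi>\<bar> \<le> 2 * pi * \<bar>\<xi>\<bar>" by simp
    qed auto
    then have "\<bar>\<xi>\<bar> ^ P * cmod (W \<xi>) \<le> (2 * pi * \<bar>\<xi>\<bar>) ^ P * cmod (W \<xi>)"
      by (intro mult_right_mono) auto
    also have "\<dots> = cmod (ft (\<lambda>t. of_real (D P t)) \<xi>)"
      by (simp add: power norm_mult norm_power)
    also have "\<dots> \<le> I P"
      unfolding I_def by (rule norm_ft_le)
    finally show ?thesis .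
  qed
  \<comment> \<open>The factor 2^P comes from (1 + |\<xi>|)^P being at most 2^P (1 + |\<xi>|^P); the
    summand 1 keeps the constant strictly positive.\<close>
  have "cmod (W \<xi>) \<le> (2 ^ P * (I 0 + I P) + 1) / (1 + \<bar>\<xi>\<bar>) ^ P" for \<xi>
  proof -
    have "(1 + \<bar>\<xi>\<bar>) ^ P \<le> (2 * max 1 \<bar>\<xi>\<bar>) ^ P"
      by (intro power_mono) auto
    also have "\<dots> = 2 ^ P * max 1 \<bar>\<xi>\<bar> ^ P"
      by (simp add: power_mult_distrib)
    also have "max 1 \<bar>\<xi>\<bar> ^ P \<le> 1 + \<bar>\<xi>\<bar> ^ P"
      by (auto simp: max_def)
    finally have "(1 + \<bar>\<xi>\<bar>) ^ P \<le> 2 ^ P * (1 + \<bar>\<xi>\<bar> ^ P)"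
      by simp
    then have "(1 + \<bar>\<xi>\<bar>) ^ P * cmod (W \<xi>) \<le> 2 ^ P * (1 + \<bar>\<xi>\<bar> ^ P) * cmod (W \<xi>)"
      by (intro mult_right_mono) auto
    also have "\<dots> = 2 ^ P * (cmod (W \<xi>) + \<bar>\<xi>\<bar> ^ P * cmod (W \<xi>))"
      by (simp add: algebra_simps)
    also have "\<dots> \<le> 2 ^ P * (I 0 + I P)"
      by (intro mult_left_mono add_mono b0 bP) auto
    finally have "(1 + \<bar>\<xi>\<bar>) ^ P * cmod (W \<xi>) \<le> 2 ^ P * (I 0 + I P) + 1"
      by simp
    then show ?thesis
      by (simp add: field_simps)
  qed
  moreover have "2 ^ P * (I 0 + I P) + 1 > 0"
    using I0[of 0] I0[of P] by (intro add_nonneg_pos mult_nonneg_nonneg) auto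
  ultimately show ?thesis
    unfolding W_def by blast
qed

lemma bump_lipschitz:
  assumes "bump w"
  shows "\<exists>K>0. \<forall>s t. \<bar>w s - w t\<bar> \<le> K * \<bar>s - t\<bar>"
proof -
  obtain D :: "nat \<Rightarrow> real \<Rightarrow> real" where D0: "D 0 = w"
    and D: "\<And>m x. (D m has_real_derivative D (Suc m) x) (at x)"
    using assms unfolding bump_def by blast
  have supp: "D 1 t = 0" if "\<bar>t\<bar> > 2" for t
    by (rule derivative_zero_outside_support[where f=w and B=2])
       (use assms that D[of 0] in \<open>auto simp: D0 bump_def\<close>)
  have "continuous_on {-2..2} (D 1)"
    using D[of 1] by (auto intro!: continuous_at_imp_continuous_on DERIV_isCont)
  then have "bounded (D 1 ` {-2..2})"
    by (intro compact_imp_bounded compact_continuous_image) auto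
  then obtain K where K: "K > 0" "\<And>t. t \<in> {-2..2} \<Longrightarrow> \<bar>D 1 t\<bar> \<le> K"
    by (auto simp: bounded_pos)
  have bd: "\<bar>D 1 t\<bar> \<le> K" for t
  proof (cases "\<bar>t\<bar> > 2")
    case False
    then have "t \<in> {-2..2}"
      by auto
    then show ?thesis
      by (rule K(2))
  qed (use K(1) supp in simp)
  have "\<bar>w s - w t\<bar> \<le> K * \<bar>s - t\<bar>" for s t
    using field_differentiable_bound[of UNIV w "D 1" K s t] D[of 0] bd by (simp add: D0)
  with K show ?thesis
    by blast
qed

section \<open>Fourier expansion of the counting function\<close>

lemma prod_cis: "finite A \<Longrightarrow> (\<Prod>j\<in>A. cis (g j)) = cis (\<Sum>j\<in>A. g j)"
  by (induction A rule: finite_induct) (auto simp: cis_mult)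

definition int_box :: "int \<Rightarrow> (int^'k) set" where
  "int_box L = {a. \<forall>j. a $ j \<in> {- L..L}}"

lemma finite_int_box [simp]: "finite (int_box L :: (int^'k) set)"
proof (rule finite_imageD)
  have "finite (PiE (UNIV::'k set) (\<lambda>_. {- L..L}))"
    by (intro finite_PiE) auto
  then show "finite (vec_nth ` (int_box L :: (int^'k) set))"
    by (rule finite_subset[rotated]) (auto simp: int_box_def)
  show "inj_on vec_nth (int_box L :: (int^'k) set)"
    by (auto simp: inj_on_def vec_nth_inject)
qed

lemma sum_int_box_prod:
  fixes f :: "'k::finite \<Rightarrow> int \<Rightarrow> 'b::comm_semiring_1"
  shows "(\<Sum>a\<in>(int_box L :: (int^'k) set). \<Prod>j\<in>UNIV. f j (a $ j)) = (\<Prod>j\<in>UNIV. \<Sum>b\<in>{- L..L}. f j b)"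
proof -
  have "(\<Prod>j\<in>UNIV. \<Sum>b\<in>{- L..L}. f j b) = (\<Sum>g\<in>PiE UNIV (\<lambda>_. {- L..L}). \<Prod>j\<in>UNIV. f j (g j))"
    by (rule prod_sum_PiE) auto
  also have "\<dots> = (\<Sum>a\<in>(int_box L :: (int^'k) set). \<Prod>j\<in>UNIV. f j (a $ j))"
    by (rule sum.reindex_bij_witness[where i=vec_nth and j=vec_lambda])
       (auto simp: PiE_UNIV_domain int_box_def)
  finally show ?thesis ..
qed

text \<open>If a leaves the box, some coordinate puts the argument of w beyond 2 and the whole
  product vanishes. So the infinite sum is finite, and a sum of products over a box factors into
  one-dimensional periodizations.\<close>

lemma A_star_eq_prod:
  fixes x y dv :: "real^'k" and L :: int
  assumes supp: "\<And>t. \<bar>t\<bar> > 2 \<Longrightarrow> w t = 0" and n: "n > 0" and dv: "\<And>j. dv $ j > 0"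
    and L: "\<And>j. 2 * (n * dv $ j) + \<bar>n * x $ j - y $ j\<bar> < real_of_int L"
  shows "A_star w dv y n x = (\<Prod>j\<in>UNIV. \<Sum>a\<in>{- L..L}. w ((n * x $ j - y $ j - of_int a) / (n * dv $ j)))"
proof -
  have arg: "(x $ j - (of_int b + y $ j) / real n) / dv $ j = (n * x $ j - y $ j - of_int b) / (n * dv $ j)" for j b
    using n dv[of j] by (simp add: field_simps)
  have "A_star w dv y n x
      = infsum (\<lambda>a. \<Prod>j\<in>UNIV. w ((n * x $ j - y $ j - of_int (a $ j)) / (n * dv $ j))) (int_box L)"
    unfolding A_star_def arg
  proof (rule infsum_cong_neutral)
    fix a :: "int^'k" assume "a \<in> UNIV - int_box L"
    then obtain j where j: "a $ j \<notin> {- L..L}"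
      by (auto simp: int_box_def)
    have pos: "n * dv $ j > 0"
      using n dv[of j] by simp
    from j have "\<bar>real_of_int (a $ j)\<bar> > real_of_int L"
      by auto
    then have "2 * (n * dv $ j) < \<bar>n * x $ j - y $ j - of_int (a $ j)\<bar>"
      using L[of j] by linarith
    then have "2 < \<bar>n * x $ j - y $ j - of_int (a $ j)\<bar> / (n * dv $ j)"
      using pos by (simp add: pos_less_divide_eq)
    also have "\<dots> = \<bar>(n * x $ j - y $ j - of_int (a $ j)) / (n * dv $ j)\<bar>"
      using pos by (simp only: abs_divide abs_of_pos)
    finally have "w ((n * x $ j - y $ j - of_int (a $ j)) / (n * dv $ j)) = 0"
      by (rule supp)
    then show "(\<Prod>j\<in>UNIV. w ((n * x $ j - y $ j - of_int (a $ j)) / (n * dv $ j))) = 0"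
      by (intro prod_zero) auto
  qed auto
  also have "\<dots> = (\<Prod>j\<in>UNIV. \<Sum>a\<in>{- L..L}. w ((n * x $ j - y $ j - of_int a) / (n * dv $ j)))"
    by (simp add: sum_int_box_prod[where f="\<lambda>j b. w ((n * x $ j - y $ j - of_int b) / (n * dv $ j))"])
  finally show ?thesis .
qed

definition freq_scale :: "nat \<Rightarrow> int^'k \<Rightarrow> int^'k" where
  "freq_scale n m = (\<chi> j. int n * m $ j)"

definition char_vec :: "int^'k \<Rightarrow> real^'k \<Rightarrow> complex" where
  "char_vec \<xi> x = cis (- 2 * pi * (\<Sum>j\<in>UNIV. of_int (\<xi> $ j) * x $ j))"

text \<open>Poisson summation for the function w(t / (n d_j)) at the point u = n x_j - y_j, one
  factor per coordinate. The dilation yields n d_j; of the phase at u the y part stays here and the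
  x part becomes the character at frequency n m.\<close>

definition A_coeff :: "(real \<Rightarrow> real) \<Rightarrow> real^'k \<Rightarrow> real^'k \<Rightarrow> nat \<Rightarrow> int^'k \<Rightarrow> complex" where
  "A_coeff w dv y n m = (\<Prod>j\<in>UNIV. of_real (n * dv $ j) * ft (\<lambda>t. of_real (w t)) (n * dv $ j * of_int (m $ j))
       * cis (2 * pi * of_int (m $ j) * y $ j))"

text \<open>Cubic partial sums are used because they factor over the coordinates: convergence and
  boundedness both reduce to dimension one.\<close>

lemma A_partial_sum_eq_prod:
  fixes x y dv :: "real^'k"
  assumes n: "n > 0" and dv: "\<And>j. dv $ j > 0"
  shows "(\<Sum>m\<in>int_box M. A_coeff w dv y n m * char_vec (freq_scale n m) x)
    = (\<Prod>j\<in>UNIV. \<Sum>m\<in>{- M..M}. ft (\<lambda>t. of_real (w (t / (n * dv $ j)))) (of_int m)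
          * cis (- 2 * pi * of_int m * (n * x $ j - y $ j)))"
proof -
  have "A_coeff w dv y n m * char_vec (freq_scale n m) x
     = (\<Prod>j\<in>UNIV. ft (\<lambda>t. of_real (w (t / (n * dv $ j)))) (of_int (m $ j))
          * cis (- 2 * pi * of_int (m $ j) * (n * x $ j - y $ j)))" for m
  proof -
    have "char_vec (freq_scale n m) x = (\<Prod>j\<in>UNIV. cis (- 2 * pi * of_int (m $ j) * (n * x $ j)))"
      by (subst prod_cis) (auto simp: char_vec_def freq_scale_def sum_distrib_left mult_ac simp flip: sum_negf)
    then have "A_coeff w dv y n m * char_vec (freq_scale n m) x
      = (\<Prod>j\<in>UNIV. of_real (n * dv $ j) * ft (\<lambda>t. of_real (w t)) (n * dv $ j * of_int (m $ j))
       * (cis (2 * pi * of_int (m $ j) * y $ j) * cis (- 2 * pi * of_int (m $ j) * (n * x $ j))))"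
      unfolding A_coeff_def by (simp only: prod.distrib[symmetric] mult.assoc)
    also have "\<dots> = (\<Prod>j\<in>UNIV. ft (\<lambda>t. of_real (w (t / (n * dv $ j)))) (of_int (m $ j))
          * cis (- 2 * pi * of_int (m $ j) * (n * x $ j - y $ j)))"
    proof (rule prod.cong)
      fix j
      have pos: "n * dv $ j > 0"
        using n dv[of j] by simp
      have "cis (2 * pi * of_int (m $ j) * y $ j) * cis (- 2 * pi * of_int (m $ j) * (n * x $ j))
              = cis (- 2 * pi * of_int (m $ j) * (n * x $ j - y $ j))"
        by (simp add: cis_mult algebra_simps)
      then show "of_real (n * dv $ j) * ft (\<lambda>t. of_real (w t)) (n * dv $ j * of_int (m $ j))
       * (cis (2 * pi * of_int (m $ j) * y $ j) * cis (- 2 * pi * of_int (m $ j) * (n * x $ j)))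
         = ft (\<lambda>t. of_real (w (t / (n * dv $ j)))) (of_int (m $ j))
          * cis (- 2 * pi * of_int (m $ j) * (n * x $ j - y $ j))"
        by (simp add: ft_dilate[OF pos, of "\<lambda>t. of_real (w t)"])
    qed simp
    finally show ?thesis .
  qed
  then show ?thesis
    by (simp only: sum_int_box_prod[where f="\<lambda>j m. ft (\<lambda>t. of_real (w (t / (n * dv $ j)))) (of_int m)
          * cis (- 2 * pi * of_int m * (n * x $ j - y $ j))"])
qed

lemma A_star_fourier_series:
  fixes x y dv :: "real^'k"
  assumes w: "bump w" and n: "n > 0" and dv: "\<And>j. dv $ j > 0"
  shows "(\<lambda>M::nat. \<Sum>m\<in>int_box (int M). A_coeff w dv y n m * char_vec (freq_scale n m) x)
           \<longlonglongrightarrow> of_real (A_star w dv y n x)"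
proof -
  have supp: "w t = 0" if "\<bar>t\<bar> > 2" for t
    using w that by (simp add: bump_def)
  obtain K where K: "K > 0" "\<And>s t. \<bar>w s - w t\<bar> \<le> K * \<bar>s - t\<bar>"
    using bump_lipschitz[OF w] by blast
  \<comment> \<open>One L has to serve all coordinates; a sum of nonnegative integers dominates each
    of its terms.\<close>
  define L where "L = (\<Sum>j\<in>UNIV. \<lfloor>2 * (n * dv $ j) + \<bar>n * x $ j - y $ j\<bar>\<rfloor> + 1)"
  have L: "2 * (n * dv $ j) + \<bar>n * x $ j - y $ j\<bar> < real_of_int L" for j
  proof -
    have "\<lfloor>2 * (n * dv $ j) + \<bar>n * x $ j - y $ j\<bar>\<rfloor> + 1 \<le> L"
      unfolding L_def
    proof (rule member_le_sum)
      show "0 \<le> \<lfloor>2 * (n * dv $ i) + \<bar>n * x $ i - y $ i\<bar>\<rfloor> + 1" for i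
        using dv[of i] by (auto intro!: add_nonneg_nonneg mult_nonneg_nonneg)
    qed auto
    then show ?thesis
      by linarith
  qed
  have L0: "0 \<le> L"
    using L[of undefined] dv[of undefined] n by (smt (verit) mult_pos_pos of_int_le_0_iff of_nat_0_less_iff)
  have lim: "(\<lambda>M::nat. \<Sum>m\<in>{- int M..int M}. ft (\<lambda>t. of_real (w (t / (n * dv $ j)))) (of_int m)
          * cis (- 2 * pi * of_int m * (n * x $ j - y $ j)))
      \<longlonglongrightarrow> (\<Sum>a\<in>{- L..L}. of_real (w ((n * x $ j - y $ j - of_int a) / (n * dv $ j))))" for j
  proof (rule poisson_summation)
    have pos: "n * dv $ j > 0"
      using n dv[of j] by simp
    show "cmod (of_real (w (s / (n * dv $ j))) - of_real (w (t / (n * dv $ j)))) \<le> (K / (n * dv $ j)) * \<bar>s - t\<bar>" for s t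
    proof -
      have "cmod (of_real (w (s / (n * dv $ j))) - of_real (w (t / (n * dv $ j))))
              = \<bar>w (s / (n * dv $ j)) - w (t / (n * dv $ j))\<bar>"
        by (simp flip: of_real_diff)
      also have "\<dots> \<le> K * \<bar>s / (n * dv $ j) - t / (n * dv $ j)\<bar>"
        by (rule K(2))
      also have "\<bar>s / (n * dv $ j) - t / (n * dv $ j)\<bar> = \<bar>s - t\<bar> / (n * dv $ j)"
        unfolding diff_divide_distrib[symmetric] using pos by (simp only: abs_divide abs_of_pos)
      finally show ?thesis
        by simp
    qed
    show "complex_of_real (w (t / (n * dv $ j))) = 0" if "\<bar>t\<bar> > 2 * (n * dv $ j)" for t
    proof -
      have "\<bar>t / (n * dv $ j)\<bar> = \<bar>t\<bar> / (n * dv $ j)"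
        using pos by (simp only: abs_divide abs_of_pos)
      then have "\<bar>t / (n * dv $ j)\<bar> > 2"
        using that pos by (simp add: pos_less_divide_eq)
      then show ?thesis
        by (simp add: supp)
    qed
  qed (use L L0 in auto)
  have "(\<lambda>M::nat. \<Sum>m\<in>int_box (int M). A_coeff w dv y n m * char_vec (freq_scale n m) x)
     \<longlonglongrightarrow> (\<Prod>j\<in>UNIV. \<Sum>a\<in>{- L..L}. of_real (w ((n * x $ j - y $ j - of_int a) / (n * dv $ j))))"
    unfolding A_partial_sum_eq_prod[OF n dv] by (intro tendsto_prod lim)
  also have "(\<Prod>j\<in>UNIV. \<Sum>a\<in>{- L..L}. of_real (w ((n * x $ j - y $ j - of_int a) / (n * dv $ j))))
     = complex_of_real (A_star w dv y n x)"
    using A_star_eq_prod[OF supp n dv L] by simp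
  finally show ?thesis .
qed

section \<open>Uniform bounds for the partial sums\<close>

lemma sum_symmetric_int_le:
  fixes g :: "nat \<Rightarrow> real"
  assumes "\<And>i. g i \<ge> 0"
  shows "(\<Sum>m\<in>{- int M..int M}. g (nat \<bar>m\<bar>)) \<le> 2 * (\<Sum>i<Suc M. g i)"
proof (induction M)
  case 0
  then show ?case
    using assms[of 0] by simp
next
  case (Suc M)
  have "{- int (Suc M)..int (Suc M)} = insert (- int (Suc M)) (insert (int (Suc M)) {- int M..int M})"
    by auto
  then have "(\<Sum>m\<in>{- int (Suc M)..int (Suc M)}. g (nat \<bar>m\<bar>)) = 2 * g (Suc M) + (\<Sum>m\<in>{- int M..int M}. g (nat \<bar>m\<bar>))"
    by (simp add: nat_add_distrib)
  then show ?case
    using Suc by simp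
qed

text \<open>Quadratic decay makes the frequencies absolutely summable. The bound may depend on
  \<delta>, since it only serves to dominate and never enters the final constant.\<close>

lemma sum_bump_ft_bounded:
  assumes w: "bump w" and \<delta>: "\<delta> > 0"
  shows "\<exists>B. \<forall>M::nat. (\<Sum>m\<in>{- int M..int M}. cmod (ft (\<lambda>t. of_real (w (t / \<delta>))) (of_int m))) \<le> B"
proof -
  obtain K where K: "K > 0" "\<And>\<xi>. cmod (ft (\<lambda>t. of_real (w t)) \<xi>) \<le> K / (1 + \<bar>\<xi>\<bar>) ^ 2"
    using bump_ft_decay[OF w] by blast
  \<comment> \<open>Chosen so that c (1 + |m|) is at most 1 + \<delta> |m|, for small and for large
    \<delta>.\<close>
  define c where "c = min 1 \<delta>"
  have c: "c > 0"
    using \<delta> by (simp add: c_def)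
  define g where "g = (\<lambda>i. \<delta> * K / c\<^sup>2 * inverse ((real (Suc i))\<^sup>2))"
  have g0: "g i \<ge> 0" for i
    using K \<delta> by (simp add: g_def)
  have summ: "summable g"
    unfolding g_def using inverse_power_summable[of 2, where 'a=real]
    by (intro summable_mult, subst summable_Suc_iff) auto
  have term_le: "cmod (ft (\<lambda>t. of_real (w (t / \<delta>))) (of_int m)) \<le> g (nat \<bar>m\<bar>)" for m
  proof -
    have eq: "cmod (ft (\<lambda>t. of_real (w (t / \<delta>))) (of_int m)) = \<delta> * cmod (ft (\<lambda>t. of_real (w t)) (\<delta> * of_int m))"
      using \<delta> by (simp add: ft_dilate[OF \<delta>, of "\<lambda>t. of_real (w t)"] norm_mult)
    have "c * (1 + \<bar>real_of_int m\<bar>) = c + c * \<bar>real_of_int m\<bar>"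
      by (simp add: algebra_simps)
    also have "\<dots> \<le> 1 + \<delta> * \<bar>real_of_int m\<bar>"
      by (intro add_mono mult_right_mono) (auto simp: c_def)
    also have "\<dots> = 1 + \<bar>\<delta> * of_int m\<bar>"
      using \<delta> by (simp add: abs_mult)
    finally have "(c * (1 + \<bar>real_of_int m\<bar>)) ^ 2 \<le> (1 + \<bar>\<delta> * of_int m\<bar>) ^ 2"
      using c by (intro power_mono) auto
    then have "K / (1 + \<bar>\<delta> * of_int m\<bar>) ^ 2 \<le> K / (c * (1 + \<bar>real_of_int m\<bar>)) ^ 2"
      using c K by (intro divide_left_mono) auto
    with K(2)[of "\<delta> * of_int m"] have "cmod (ft (\<lambda>t. of_real (w t)) (\<delta> * of_int m)) \<le> K / (c * (1 + \<bar>real_of_int m\<bar>)) ^ 2"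
      by linarith
    then have "\<delta> * cmod (ft (\<lambda>t. of_real (w t)) (\<delta> * of_int m)) \<le> \<delta> * (K / (c * (1 + \<bar>real_of_int m\<bar>)) ^ 2)"
      using \<delta> by (intro mult_left_mono) auto
    also have "\<dots> = g (nat \<bar>m\<bar>)"
      by (simp add: g_def power_mult_distrib divide_simps)
    finally show ?thesis
      by (simp add: eq)
  qed
  have "(\<Sum>m\<in>{- int M..int M}. cmod (ft (\<lambda>t. of_real (w (t / \<delta>))) (of_int m))) \<le> 2 * suminf g" for M
  proof -
    have "(\<Sum>m\<in>{- int M..int M}. cmod (ft (\<lambda>t. of_real (w (t / \<delta>))) (of_int m))) \<le> (\<Sum>m\<in>{- int M..int M}. g (nat \<bar>m\<bar>))"
      by (intro sum_mono term_le)
    also have "\<dots> \<le> 2 * (\<Sum>i<Suc M. g i)"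
      by (intro sum_symmetric_int_le g0)
    also have "\<dots> \<le> 2 * suminf g"
      by (intro mult_left_mono sum_le_suminf summ) (auto simp: g0)
    finally show ?thesis .
  qed
  then show ?thesis
    by blast
qed

lemma A_partial_sum_bounded:
  fixes y dv :: "real^'k"
  assumes w: "bump w" and n: "n > 0" and dv: "\<And>j. dv $ j > 0"
  shows "\<exists>B. \<forall>(M::nat) x. cmod (\<Sum>m\<in>int_box (int M). A_coeff w dv y n m * char_vec (freq_scale n m) x) \<le> B"
proof -
  have "\<exists>B. \<forall>M::nat. (\<Sum>m\<in>{- int M..int M}. cmod (ft (\<lambda>t. of_real (w (t / (n * dv $ j)))) (of_int m))) \<le> B" for j
    using n dv[of j] by (intro sum_bump_ft_bounded w) auto
  then obtain B where B: "\<And>j M. (\<Sum>m\<in>{- int M..int M}. cmod (ft (\<lambda>t. of_real (w (t / (n * dv $ j)))) (of_int m))) \<le> B j"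
    by metis
  have "cmod (\<Sum>m\<in>int_box (int M). A_coeff w dv y n m * char_vec (freq_scale n m) x) \<le> (\<Prod>j\<in>UNIV. B j)" for M x
    unfolding A_partial_sum_eq_prod[OF n dv] prod_norm[symmetric]
  proof (intro prod_mono conjI norm_ge_zero)
    fix j
    show "cmod (\<Sum>m\<in>{- int M..int M}. ft (\<lambda>t. of_real (w (t / (n * dv $ j)))) (of_int m)
          * cis (- 2 * pi * of_int m * (n * x $ j - y $ j))) \<le> B j"
      by (rule order.trans[OF norm_sum], rule order.trans[OF _ B[where M=M]]) (simp add: norm_mult)
  qed
  then show ?thesis
    by blast
qed

section \<open>Integration of the series against a measure\<close>

text \<open>Integrating over the cube only, as \<open>meas_int\<close> does, lets the infinite
  measure \<open>lborel\<close> be treated together with \<mu>.\<close>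

definition cube_coeff :: "(real^'k) measure \<Rightarrow> int^'k \<Rightarrow> complex" where
  "cube_coeff \<nu> \<xi> = (LINT x:unit_cube|\<nu>. char_vec \<xi> x)"

lemma char_vec_measurable [measurable]: "char_vec \<xi> \<in> borel_measurable borel"
  unfolding char_vec_def
  by (intro borel_measurable_continuous_onI continuous_intros)

lemma norm_char_vec [simp]: "cmod (char_vec \<xi> x) = 1"
  by (simp add: char_vec_def)

lemma mem_unit_cube: "(x :: real^'k) \<in> unit_cube \<longleftrightarrow> (\<forall>j. x $ j \<in> {0..1})"
proof -
  have "x \<in> unit_cube \<longleftrightarrow> (\<forall>b\<in>Basis. 0 \<le> x \<bullet> b \<and> x \<bullet> b \<le> 1)"
    by (simp add: mem_box)
  also have "\<dots> \<longleftrightarrow> (\<forall>j. x $ j \<in> {0..1})"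
    by (auto simp: Basis_vec_def inner_axis)
  finally show ?thesis .
qed

text \<open>Dominated convergence, with a constant on the cube as the dominating function. The
  pointwise limit holds at every x, so no relation between \<nu> and Lebesgue measure
  enters.\<close>

lemma meas_int_A_star_fourier_series:
  fixes y dv :: "real^'k" and \<nu> :: "(real^'k) measure"
  assumes w: "bump w" and n: "n > 0" and dv: "\<And>j. dv $ j > 0"
    and sets: "sets \<nu> = sets borel" and fin: "emeasure \<nu> unit_cube < \<infinity>"
  shows "(\<lambda>M::nat. \<Sum>m\<in>int_box (int M). A_coeff w dv y n m * cube_coeff \<nu> (freq_scale n m))
           \<longlonglongrightarrow> of_real (meas_int \<nu> (A_star w dv y n))"
proof -
  define s where "s = (\<lambda>(M::nat) x. \<Sum>m\<in>int_box (int M). A_coeff w dv y n m * char_vec (freq_scale n m) x)"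
  obtain B where B: "\<And>M x. cmod (s M x) \<le> B"
    using A_partial_sum_bounded[OF w n dv] unfolding s_def by metis
  have cube [measurable]: "unit_cube \<in> sets \<nu>"
    by (simp add: sets)
  have char_meas: "char_vec \<xi> \<in> borel_measurable \<nu>" for \<xi> :: "int^'k"
    using char_vec_measurable measurable_cong_sets[OF sets refl] by blast
  have s_meas: "s M \<in> borel_measurable \<nu>" for M
    unfolding s_def by (intro borel_measurable_sum borel_measurable_times borel_measurable_const char_meas)
  have lim: "(\<lambda>M. s M x) \<longlonglongrightarrow> of_real (A_star w dv y n x)" for x
    unfolding s_def by (rule A_star_fourier_series[OF w n dv])
  \<comment> \<open>Measurability of \<open>A_star\<close> is inherited from the partial sums, whose
    limit it is.\<close>
  have A_meas: "(\<lambda>x. complex_of_real (A_star w dv y n x)) \<in> borel_measurable \<nu>"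
    using s_meas lim by (rule borel_measurable_LIMSEQ_metric)
  have int_char: "integrable \<nu> (\<lambda>x. indicator unit_cube x *\<^sub>R char_vec \<xi> x)" for \<xi> :: "int^'k"
    by (rule Bochner_Integration.integrable_bound[where f="indicator unit_cube :: _ \<Rightarrow> real"])
       (use fin char_meas in \<open>auto intro!: integrable_real_indicator borel_measurable_scaleR\<close>)
  have "(\<lambda>M. \<integral>x. indicator unit_cube x *\<^sub>R s M x \<partial>\<nu>)
          \<longlonglongrightarrow> (\<integral>x. indicator unit_cube x *\<^sub>R complex_of_real (A_star w dv y n x) \<partial>\<nu>)"
  proof (rule integral_dominated_convergence)
    show "integrable \<nu> (\<lambda>x. B * indicator unit_cube x :: real)"
      using fin by (intro integrable_mult_right integrable_real_indicator) auto
    show "(\<lambda>x. indicator unit_cube x *\<^sub>R complex_of_real (A_star w dv y n x)) \<in> borel_measurable \<nu>"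
      using A_meas by (intro borel_measurable_scaleR) auto
    show "(\<lambda>x. indicator unit_cube x *\<^sub>R s M x) \<in> borel_measurable \<nu>" for M
      using s_meas by (intro borel_measurable_scaleR) auto
    show "AE x in \<nu>. (\<lambda>M. indicator unit_cube x *\<^sub>R s M x) \<longlonglongrightarrow> indicator unit_cube x *\<^sub>R complex_of_real (A_star w dv y n x)"
      by (intro AE_I2 tendsto_scaleR tendsto_const lim)
    show "AE x in \<nu>. norm (indicator unit_cube x *\<^sub>R s M x) \<le> B * indicator unit_cube x" for M
      using B by (auto simp: indicator_def)
  qed
  also have "(\<lambda>M. \<integral>x. indicator unit_cube x *\<^sub>R s M x \<partial>\<nu>)
      = (\<lambda>M::nat. \<Sum>m\<in>int_box (int M). A_coeff w dv y n m * cube_coeff \<nu> (freq_scale n m))"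
  proof
    fix M
    have "(\<integral>x. indicator unit_cube x *\<^sub>R s M x \<partial>\<nu>)
        = (\<integral>x. (\<Sum>m\<in>int_box (int M). A_coeff w dv y n m * (indicator unit_cube x *\<^sub>R char_vec (freq_scale n m) x)) \<partial>\<nu>)"
      by (simp add: s_def scaleR_sum_right)
    also have "\<dots> = (\<Sum>m\<in>int_box (int M). A_coeff w dv y n m * cube_coeff \<nu> (freq_scale n m))"
      unfolding cube_coeff_def set_lebesgue_integral_def
      by (subst Bochner_Integration.integral_sum)
         (intro integrable_mult_right int_char, simp only: integral_mult_right_zero)
    finally show "(\<integral>x. indicator unit_cube x *\<^sub>R s M x \<partial>\<nu>)
      = (\<Sum>m\<in>int_box (int M). A_coeff w dv y n m * cube_coeff \<nu> (freq_scale n m))" .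
  qed
  also have "(\<integral>x. indicator unit_cube x *\<^sub>R complex_of_real (A_star w dv y n x) \<partial>\<nu>)
      = of_real (meas_int \<nu> (A_star w dv y n))"
    unfolding meas_int_def set_lebesgue_integral_def
    by (subst integral_complex_of_real[symmetric]) (simp add: scaleR_conv_of_real)
  finally show ?thesis .
qed

lemma cube_coeff_eq_fourier_coeff:
  assumes "borel_prob_on_cube \<mu>"
  shows "cube_coeff \<mu> \<xi> = fourier_coeff \<mu> \<xi>"
proof -
  interpret prob_space \<mu>
    using assms by (simp add: borel_prob_on_cube_def)
  have sets: "sets \<mu> = sets borel" and one: "emeasure \<mu> unit_cube = 1"
    using assms by (auto simp: borel_prob_on_cube_def)
  have cube: "unit_cube \<in> sets \<mu>"
    by (simp add: sets)
  have AE: "AE x in \<mu>. x \<in> unit_cube"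
    using cube one by (intro AE_prob_1) (simp add: measure_def)
  have char_meas: "char_vec \<xi> \<in> borel_measurable \<mu>"
    using char_vec_measurable measurable_cong_sets[OF sets refl] by blast
  have "cube_coeff \<mu> \<xi> = (\<integral>x. char_vec \<xi> x \<partial>\<mu>)"
    unfolding cube_coeff_def set_lebesgue_integral_def
  proof (rule integral_cong_AE)
    show "(\<lambda>x. indicator unit_cube x *\<^sub>R char_vec \<xi> x) \<in> borel_measurable \<mu>"
      using char_meas cube by (intro borel_measurable_scaleR) auto
    show "AE x in \<mu>. indicator unit_cube x *\<^sub>R char_vec \<xi> x = char_vec \<xi> x"
      using AE by eventually_elim simp
  qed (rule char_meas)
  then show ?thesis
    by (simp add: fourier_coeff_def char_vec_def)
qed

lemma prod_Basis_vec:
  fixes h :: "real^'k \<Rightarrow> 'b::comm_monoid_mult"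
  shows "(\<Prod>b\<in>Basis. h b) = (\<Prod>j\<in>UNIV. h (axis j 1))"
proof -
  have "(Basis :: (real^'k) set) = range (\<lambda>j. axis j 1)"
    by (auto simp: Basis_vec_def)
  moreover have "inj (\<lambda>j::'k. axis j (1::real))"
    by (auto simp: inj_def axis_eq_axis)
  ultimately show ?thesis
    using prod.reindex[of "\<lambda>j::'k. axis j (1::real)" UNIV h] by (simp add: comp_def)
qed

text \<open>Fubini reduces to the orthogonality of characters on [0,1]. The indicator of the cube is
  split among the coordinates, so that every factor is integrable on the whole line.\<close>

lemma cube_coeff_lborel:
  fixes \<xi> :: "int^'k"
  shows "cube_coeff lborel \<xi> = (if \<xi> = 0 then 1 else 0)"
proof -
  define g where "g = (\<lambda>(b::real^'k) t. indicator {0..1} t *\<^sub>R cis (2 * pi * of_int (- \<xi> $ axis_index b) * t))"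
  have g_int: "integrable lborel (g b)" for b
    unfolding g_def by (rule borel_integrable_compact) (auto intro!: continuous_intros)
  have eq: "indicator unit_cube x *\<^sub>R char_vec \<xi> x = (\<Prod>b\<in>Basis. g b (x \<bullet> b))" for x :: "real^'k"
  proof -
    have "(\<Prod>b\<in>Basis. g b (x \<bullet> b)) = (\<Prod>j\<in>UNIV. indicator {0..1} (x $ j) *\<^sub>R cis (2 * pi * of_int (- \<xi> $ j) * x $ j))"
      by (simp add: prod_Basis_vec g_def inner_axis)
    also have "\<dots> = (\<Prod>j\<in>UNIV. of_real (indicator {0..1} (x $ j))) * (\<Prod>j\<in>UNIV. cis (2 * pi * of_int (- \<xi> $ j) * x $ j))"
      by (simp add: scaleR_conv_of_real prod.distrib)
    also have "(\<Prod>j\<in>UNIV. cis (2 * pi * of_int (- \<xi> $ j) * x $ j)) = char_vec \<xi> x"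
      by (subst prod_cis) (auto simp: char_vec_def sum_distrib_left mult_ac sum_negf)
    also have "(\<Prod>j\<in>UNIV. complex_of_real (indicator {0..1} (x $ j))) = of_real (indicator unit_cube x)"
    proof (cases "x \<in> unit_cube")
      case True
      then show ?thesis
        by (simp add: mem_unit_cube)
    next
      case False
      then obtain j where "x $ j \<notin> {0..1}"
        by (auto simp: mem_unit_cube)
      then have "indicator {0..1} (x $ j) = (0 :: real)"
        by (rule indicator_simps)
      with False show ?thesis
        by (auto intro!: prod_zero)
    qed
    finally show ?thesis
      by (simp add: scaleR_conv_of_real)
  qed
  interpret product_sigma_finite "\<lambda>_::real^'k. lborel :: real measure" ..
  have meas: "(\<lambda>x::real^'k. \<Prod>b\<in>Basis. g b (x \<bullet> b)) \<in> borel_measurable borel"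
    unfolding eq[symmetric] by (intro borel_measurable_scaleR) auto
  have "cube_coeff lborel \<xi> = (\<integral>x. (\<Prod>b\<in>Basis. g b (x \<bullet> b)) \<partial>(lborel :: (real^'k) measure))"
    unfolding cube_coeff_def set_lebesgue_integral_def eq ..
  also have "\<dots> = (\<integral>f. (\<Prod>b\<in>Basis. g b ((\<Sum>b\<in>Basis. f b *\<^sub>R b) \<bullet> b)) \<partial>(\<Pi>\<^sub>M b\<in>(Basis::(real^'k) set). lborel))"
    \<comment> \<open>\<open>lborel\<close> is the image of a product of one-dimensional Lebesgue
      measures under the map from coordinates to vectors.\<close>
    using meas by (subst lborel_eq, subst integral_distr) auto
  also have "\<dots> = (\<integral>f. (\<Prod>b\<in>Basis. g b (f b)) \<partial>(\<Pi>\<^sub>M b\<in>(Basis::(real^'k) set). lborel))"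
    by (intro Bochner_Integration.integral_cong prod.cong) auto
  also have "\<dots> = (\<Prod>b\<in>Basis. \<integral>t. g b t \<partial>lborel)"
    using g_int by (intro product_integral_prod) auto
  also have "\<dots> = (\<Prod>j\<in>UNIV. \<integral>t. cis (2 * pi * of_int (- \<xi> $ j) * t) \<partial>unit_ivl)"
    by (simp add: prod_Basis_vec g_def integral_unit_ivl)
  also have "\<dots> = (\<Prod>j\<in>UNIV. if \<xi> $ j = 0 then 1 else 0)"
    by (subst integral_unit_ivl_cis) simp
  also have "\<dots> = (if \<xi> = 0 then 1 else 0)"
    by (auto simp: vec_eq_iff intro!: prod_zero)
  finally show ?thesis .
qed

section \<open>Summation over frequencies\<close>

text \<open>Splits the sum according to the integer part of \<open>r x / R\<close>; the two extra powers of decay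
  make the sum over the levels converge.\<close>
lemma sum_weighted_by_level_le:
  fixes b r :: "'a \<Rightarrow> real" and R \<sigma> k C :: real
  assumes fin: "finite F"
    and b: "\<And>x. x \<in> F \<Longrightarrow> b x \<ge> 0" and r: "\<And>x. x \<in> F \<Longrightarrow> r x \<ge> 0"
    and growth: "\<And>Q. Q \<ge> 1 \<Longrightarrow> (\<Sum>x | x \<in> F \<and> r x \<le> Q. b x) \<le> C * Q powr \<sigma>"
    and R: "R \<ge> 1" and \<sigma>: "\<sigma> \<le> k" and k: "k \<ge> 0"
  shows "(\<Sum>x\<in>F. b x * (1 + r x / R) powr (- (k + 2)))
           \<le> C * (\<Sum>i. inverse ((real (Suc i))\<^sup>2)) * R powr \<sigma>"
proof -
  define lev where "lev = (\<lambda>x. nat \<lfloor>r x / R\<rfloor>)"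
  have "0 \<le> (\<Sum>x | x \<in> F \<and> r x \<le> 1. b x)"
    using b by (intro sum_nonneg) auto
  with growth[of 1] have C: "C \<ge> 0"
    by simp
  have summ: "summable (\<lambda>i. inverse ((real (Suc i))\<^sup>2))"
    using inverse_power_summable[of 2, where 'a=real] by (subst summable_Suc_iff) auto
  have level: "(\<Sum>x | x \<in> F \<and> lev x = i. b x * (1 + r x / R) powr (- (k + 2)))
                 \<le> C * R powr \<sigma> * inverse ((real (Suc i))\<^sup>2)" for i
  proof -
    have low: "real i \<le> r x / R" and up: "r x \<le> real (Suc i) * R" if "x \<in> F" "lev x = i" for x
    proof -
      have 0: "0 \<le> r x / R"
        using r[OF that(1)] R by simp
      then have i: "real i = of_int \<lfloor>r x / R\<rfloor>"
        using that(2) by (auto simp: lev_def)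
      show "real i \<le> r x / R"
        unfolding i by simp
      have "r x / R \<le> real (Suc i)"
        using i by (simp, linarith)
      then show "r x \<le> real (Suc i) * R"
        using R by (simp add: field_simps)
    qed
    have "(\<Sum>x | x \<in> F \<and> lev x = i. b x * (1 + r x / R) powr (- (k + 2)))
            \<le> (\<Sum>x | x \<in> F \<and> lev x = i. b x * real (Suc i) powr (- (k + 2)))"
    proof (intro sum_mono mult_left_mono)
      fix x assume x: "x \<in> {x. x \<in> F \<and> lev x = i}"
      show "0 \<le> b x"
        using x b by auto
      show "(1 + r x / R) powr (- (k + 2)) \<le> real (Suc i) powr (- (k + 2))"
        using low[of x] x k by (intro powr_mono2') auto
    qed
    also have "\<dots> = (\<Sum>x | x \<in> F \<and> lev x = i. b x) * real (Suc i) powr (- (k + 2))"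
      by (simp add: sum_distrib_right)
    also have "\<dots> \<le> (C * (real (Suc i) * R) powr \<sigma>) * real (Suc i) powr (- (k + 2))"
    proof (intro mult_right_mono)
      have "1 * 1 \<le> real (Suc i) * R"
        using R by (intro mult_mono) auto
      then have "(\<Sum>x | x \<in> F \<and> r x \<le> real (Suc i) * R. b x) \<le> C * (real (Suc i) * R) powr \<sigma>"
        by (intro growth) auto
      moreover have "(\<Sum>x | x \<in> F \<and> lev x = i. b x) \<le> (\<Sum>x | x \<in> F \<and> r x \<le> real (Suc i) * R. b x)"
        using fin up b by (intro sum_mono2) auto
      ultimately show "(\<Sum>x | x \<in> F \<and> lev x = i. b x) \<le> C * (real (Suc i) * R) powr \<sigma>"
        by linarith
    qed auto
    also have "\<dots> = C * R powr \<sigma> * real (Suc i) powr (\<sigma> - k - 2)"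
      using R by (simp add: powr_mult powr_diff powr_minus powr_add divide_simps)
    \<comment> \<open>Level i has height at most (i+1) R and hence mass O((i+1)^\<sigma>
      R^\<sigma>); as \<sigma> is at most k, the weight leaves the summable (i+1)^(-2).\<close>
    also have "\<dots> \<le> C * R powr \<sigma> * real (Suc i) powr (- 2)"
      using C \<sigma> by (intro mult_left_mono powr_mono) auto
    also have "real (Suc i) powr (- 2) = inverse ((real (Suc i))\<^sup>2)"
      by (simp add: powr_minus powr_numeral)
    finally show ?thesis .
  qed
  have "(\<Sum>x\<in>F. b x * (1 + r x / R) powr (- (k + 2)))
          = (\<Sum>i\<in>lev ` F. \<Sum>x | x \<in> F \<and> lev x = i. b x * (1 + r x / R) powr (- (k + 2)))"
    using fin by (rule sum.image_gen)
  also have "\<dots> \<le> (\<Sum>i\<in>lev ` F. C * R powr \<sigma> * inverse ((real (Suc i))\<^sup>2))"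
    by (intro sum_mono level)
  also have "\<dots> = C * R powr \<sigma> * (\<Sum>i\<in>lev ` F. inverse ((real (Suc i))\<^sup>2))"
    by (simp add: sum_distrib_left)
  also have "\<dots> \<le> C * R powr \<sigma> * (\<Sum>i. inverse ((real (Suc i))\<^sup>2))"
    using fin C by (intro mult_left_mono sum_le_suminf summ) auto
  finally show ?thesis
    by (simp add: mult_ac)
qed

section \<open>Frequency boxes and the l1 dimension\<close>

definition sup_norm :: "int^'k \<Rightarrow> int" where
  "sup_norm \<xi> = Max (range (\<lambda>j. \<bar>\<xi> $ j\<bar>))"

lemma abs_nth_le_sup_norm: "\<bar>\<xi> $ j\<bar> \<le> sup_norm \<xi>"
  unfolding sup_norm_def by (rule Max_ge) auto

lemma sup_norm_attained: "\<exists>j. sup_norm \<xi> = \<bar>\<xi> $ j\<bar>"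
proof -
  have "sup_norm \<xi> \<in> range (\<lambda>j. \<bar>\<xi> $ j\<bar>)"
    unfolding sup_norm_def by (rule Max_in) auto
  then show ?thesis
    by auto
qed

lemma sup_norm_nonneg [simp]: "sup_norm \<xi> \<ge> 0"
  using sup_norm_attained[of \<xi>] by auto

lemma sup_norm_pos: "\<xi> \<noteq> 0 \<Longrightarrow> sup_norm \<xi> > 0"
proof (rule ccontr)
  assume "\<xi> \<noteq> 0" "\<not> sup_norm \<xi> > 0"
  then have "\<bar>\<xi> $ j\<bar> \<le> 0" for j
    using abs_nth_le_sup_norm[of \<xi> j] by linarith
  with \<open>\<xi> \<noteq> 0\<close> show False
    by (simp add: vec_eq_iff)
qed

lemma sup_norm_le_iff: "real_of_int (sup_norm \<xi>) \<le> Q \<longleftrightarrow> (\<forall>j. real_of_int \<bar>\<xi> $ j\<bar> \<le> Q)"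
  using sup_norm_attained[of \<xi>] abs_nth_le_sup_norm[of \<xi>]
  by (metis (no_types, lifting) of_int_le_iff order.trans)

lemma freq_box_eq_int_box: "{\<xi>::int^'k. \<forall>j. real_of_int \<bar>\<xi> $ j\<bar> \<le> Q} = int_box \<lfloor>Q\<rfloor>"
proof -
  have "real_of_int \<bar>i\<bar> \<le> Q \<longleftrightarrow> i \<in> {- \<lfloor>Q\<rfloor>..\<lfloor>Q\<rfloor>}" for i
    unfolding le_floor_iff[symmetric] by auto
  then show ?thesis
    by (simp add: int_box_def)
qed

lemma card_int_box: "L \<ge> 0 \<Longrightarrow> card (int_box L :: (int^'k) set) = nat (2 * L + 1) ^ CARD('k)"
  using sum_int_box_prod[where f="\<lambda>(_::'k) _. 1::nat" and L=L] by simp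

lemma norm_fourier_coeff_le:
  assumes "borel_prob_on_cube \<mu>"
  shows "cmod (fourier_coeff \<mu> \<xi>) \<le> 1"
proof -
  interpret prob_space \<mu>
    using assms by (simp add: borel_prob_on_cube_def)
  have "cmod (fourier_coeff \<mu> \<xi>) \<le> (\<integral>x. 1 \<partial>\<mu>)"
    unfolding fourier_coeff_def by (rule order.trans[OF integral_norm_bound]) simp
  then show ?thesis
    by (simp add: prob_space)
qed

text \<open>Counts the frequencies, at most 3Q per coordinate. It puts 0 among the admissible
  exponents, so the supremum in \<open>dim_l1\<close> is over a nonempty set.\<close>

lemma fourier_l1_sum_trivial_bound:
  fixes \<mu> :: "(real^'k) measure"
  assumes \<mu>: "borel_prob_on_cube \<mu>" and Q: "Q \<ge> 1"
  shows "fourier_l1_sum \<mu> Q \<le> 3 ^ CARD('k) * Q powr real CARD('k)"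
proof -
  have "fourier_l1_sum \<mu> Q \<le> (\<Sum>\<xi>\<in>(int_box \<lfloor>Q\<rfloor> :: (int^'k) set). 1)"
    unfolding fourier_l1_sum_def freq_box_eq_int_box by (intro sum_mono norm_fourier_coeff_le \<mu>)
  also have "\<dots> = real (nat (2 * \<lfloor>Q\<rfloor> + 1)) ^ CARD('k)"
    using Q by (simp add: card_int_box)
  also have "\<dots> \<le> (3 * Q) ^ CARD('k)"
    using Q by (intro power_mono) (auto, linarith)
  also have "\<dots> = 3 ^ CARD('k) * Q powr real CARD('k)"
    using Q by (simp add: power_mult_distrib powr_realpow)
  finally show ?thesis .
qed

text \<open>The supremum need not be attained, so the growth bound is available only for an exponent
  that falls short of the dimension by less than \<eta>.\<close>

lemma dim_l1_approx:
  fixes \<mu> :: "(real^'k) measure"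
  assumes \<mu>: "borel_prob_on_cube \<mu>" and "\<eta> > 0"
  obtains s C where "s \<ge> 0" "s > dim_l1 \<mu> - \<eta>"
    "\<And>Q. Q \<ge> 1 \<Longrightarrow> fourier_l1_sum \<mu> Q \<le> C * Q powr (real CARD('k) - s)"
proof -
  define X where "X = {s. s \<ge> 0 \<and> (\<exists>C. \<forall>Q\<ge>1. fourier_l1_sum \<mu> Q \<le> C * Q powr (real CARD('k) - s))}"
  have "0 \<in> X"
    using fourier_l1_sum_trivial_bound[OF \<mu>] by (auto simp: X_def)
  moreover have "dim_l1 \<mu> - \<eta> < Sup X"
    using \<open>\<eta> > 0\<close> by (simp add: dim_l1_def X_def)
  ultimately obtain s where "s \<in> X" "dim_l1 \<mu> - \<eta> < s"
    by (metis empty_iff less_cSupE)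
  with that show ?thesis
    by (auto simp: X_def)
qed

text \<open>All decay is taken from the one coordinate i that attains the sup norm: as d_i is at
  least 1/R, the argument n d_i m_i has modulus at least |n m|/R. The other coordinates contribute
  at most T K each.\<close>

lemma norm_A_coeff_le:
  fixes dv y :: "real^'k"
  assumes decay: "\<And>\<xi>. cmod (ft (\<lambda>t. of_real (w t)) \<xi>) \<le> K / (1 + \<bar>\<xi>\<bar>) ^ P"
    and K: "K \<ge> 0" and R: "R > 0"
    and low: "\<And>j. 1 / R \<le> dv $ j" and up: "\<And>j. n * dv $ j \<le> T"
  shows "cmod (A_coeff w dv y n m) \<le> (T * K) ^ CARD('k) / (1 + sup_norm (freq_scale n m) / R) ^ P"
proof -
  obtain i where i: "sup_norm (freq_scale n m) = \<bar>freq_scale n m $ i\<bar>"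
    using sup_norm_attained by blast
  define q where "q = 1 / (1 + sup_norm (freq_scale n m) / R) ^ P"
  have dv0: "dv $ j \<ge> 0" for j
    using low[of j] R by (smt (verit) divide_pos_pos)
  have T0: "T \<ge> 0"
    using up[of i] dv0[of i] by (smt (verit) mult_nonneg_nonneg of_nat_0_le_iff)
  have fac: "cmod (of_real (n * dv $ j) * ft (\<lambda>t. of_real (w t)) (n * dv $ j * of_int (m $ j))
       * cis (2 * pi * of_int (m $ j) * y $ j)) \<le> (T * K) * (if j = i then q else 1)" for j
  proof -
    have "1 + (if j = i then sup_norm (freq_scale n m) / R else 0) \<le> 1 + \<bar>n * dv $ j * of_int (m $ j)\<bar>"
    proof (cases "j = i")
      case True
      have "sup_norm (freq_scale n m) / R = (1 / R) * \<bar>n * of_int (m $ i)\<bar>"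
        unfolding i using R by (simp add: freq_scale_def abs_mult)
      also have "\<dots> \<le> dv $ i * \<bar>n * of_int (m $ i)\<bar>"
        by (intro mult_right_mono low) auto
      also have "\<dots> = \<bar>n * dv $ i * of_int (m $ i)\<bar>"
        using dv0[of i] by (simp add: abs_mult)
      finally show ?thesis
        using True by simp
    qed simp
    then have "(1 + (if j = i then sup_norm (freq_scale n m) / R else 0)) ^ P \<le> (1 + \<bar>n * dv $ j * of_int (m $ j)\<bar>) ^ P"
      using R by (intro power_mono) auto
    then have "K / (1 + \<bar>n * dv $ j * of_int (m $ j)\<bar>) ^ P
        \<le> K / (1 + (if j = i then sup_norm (freq_scale n m) / R else 0)) ^ P"
      using K R by (intro divide_left_mono mult_pos_pos zero_less_power) (auto intro!: add_pos_nonneg)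
    also have "\<dots> = K * (if j = i then q else 1)"
      by (simp add: q_def)
    finally have "cmod (ft (\<lambda>t. of_real (w t)) (n * dv $ j * of_int (m $ j))) \<le> K * (if j = i then q else 1)"
      using decay[of "n * dv $ j * of_int (m $ j)"] by linarith
    then have "(n * dv $ j) * cmod (ft (\<lambda>t. of_real (w t)) (n * dv $ j * of_int (m $ j)))
        \<le> T * (K * (if j = i then q else 1))"
      using up[of j] T0 by (intro mult_mono) auto
    then show ?thesis
      using dv0[of j] by (simp add: norm_mult abs_mult mult_ac)
  qed
  have "cmod (A_coeff w dv y n m) \<le> (\<Prod>j\<in>UNIV. (T * K) * (if j = i then q else 1))"
    unfolding A_coeff_def prod_norm[symmetric] by (intro prod_mono conjI norm_ge_zero fac)
  also have "\<dots> = (T * K) ^ CARD('k) * q"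
    by (simp only: prod.distrib prod_constant prod.delta finite_UNIV) (simp add: power_mult_distrib)
  finally show ?thesis
    by (simp add: q_def)
qed

lemma freq_scale_zero [simp]: "freq_scale n 0 = 0"
  by (simp add: freq_scale_def vec_eq_iff)

lemma freq_scale_eq_iff: "n > 0 \<Longrightarrow> freq_scale n m = freq_scale n m' \<longleftrightarrow> m = m'"
  by (simp add: freq_scale_def vec_eq_iff)

text \<open>The map from (n, m) to (n m, n) is injective, and n divides the sup norm of n m. So a
  nonzero frequency is hit at most as often as the single integer |\<xi>| has divisors. The larger
  box arises from n < 2N.\<close>

lemma sum_freq_scale_le_divisors:
  fixes g :: "int^'k \<Rightarrow> real"
  assumes g: "\<And>\<xi>. g \<xi> \<ge> 0" and N: "N \<ge> 1"
  shows "(\<Sum>n\<in>{N..<2*N}. \<Sum>m\<in>int_box (int M) - {0}. g (freq_scale n m))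
     \<le> (\<Sum>\<xi>\<in>int_box (int (2 * N * M)) - {0}. real (card {n. n dvd nat (sup_norm \<xi>)}) * g \<xi>)"
proof -
  define X where "X = (int_box (int (2 * N * M)) - {0} :: (int^'k) set)"
  define D where "D = (\<lambda>\<xi>::int^'k. {n. n dvd nat (sup_norm \<xi>)})"
  define \<phi> where "\<phi> = (\<lambda>(n, m::int^'k). (freq_scale n m, n))"
  define A where "A = {N..<2*N} \<times> (int_box (int M) - {0} :: (int^'k) set)"
  have fin_D: "finite (D \<xi>)" if "\<xi> \<in> X" for \<xi>
    using that sup_norm_pos[of \<xi>] by (auto simp: D_def X_def intro!: finite_divisors_nat)
  have inj: "inj_on \<phi> A"
    using N by (auto simp: inj_on_def \<phi>_def A_def freq_scale_eq_iff)
  have sub: "\<phi> ` A \<subseteq> Sigma X D"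
  proof safe
    fix n :: nat and m \<xi> :: "int^'k" and n' assume A: "(n, m) \<in> A" and eq: "(\<xi>, n') = \<phi> (n, m)"
    then have eqs: "\<xi> = freq_scale n m" "n' = n"
      by (auto simp: \<phi>_def)
    have n: "N \<le> n" "n < 2 * N" and m: "m \<in> int_box (int M)" "m \<noteq> 0"
      using A by (auto simp: A_def)
    show "\<xi> \<in> X"
      unfolding X_def
    proof safe
      show "\<xi> \<in> int_box (int (2 * N * M))"
        unfolding int_box_def
      proof (intro CollectI allI)
        fix j
        have "\<bar>m $ j\<bar> \<le> int M"
          using m by (auto simp: int_box_def abs_le_iff) (metis minus_le_iff)
        then have "int n * \<bar>m $ j\<bar> \<le> int (2 * N) * int M"
          using n by (intro mult_mono) auto
        then have "\<bar>\<xi> $ j\<bar> \<le> int (2 * N * M)"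
          by (simp add: eqs freq_scale_def abs_mult)
        then show "\<xi> $ j \<in> {- int (2 * N * M)..int (2 * N * M)}"
          by auto
      qed
      assume "\<xi> = 0"
      then show False
        using eqs m n N freq_scale_eq_iff[of n m 0] by simp
    qed
    obtain j where "sup_norm \<xi> = \<bar>\<xi> $ j\<bar>"
      using sup_norm_attained by blast
    then have "sup_norm \<xi> = int n * \<bar>m $ j\<bar>"
      by (simp add: eqs freq_scale_def abs_mult)
    then have "nat (sup_norm \<xi>) = n * nat \<bar>m $ j\<bar>"
      by (simp add: nat_mult_distrib)
    then show "n' \<in> D \<xi>"
      by (simp add: D_def eqs)
  qed
  have "(\<Sum>n\<in>{N..<2*N}. \<Sum>m\<in>int_box (int M) - {0}. g (freq_scale n m)) = (\<Sum>p\<in>A. g (fst (\<phi> p)))"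
    unfolding A_def by (subst sum.cartesian_product) (auto simp: \<phi>_def intro!: sum.cong)
  also have "\<dots> = (\<Sum>p\<in>\<phi> ` A. g (fst p))"
    using inj by (simp add: sum.reindex)
  also have "\<dots> \<le> (\<Sum>p\<in>Sigma X D. g (fst p))"
  proof (intro sum_mono2 sub g)
    show "finite (Sigma X D)"
      using fin_D by (intro finite_SigmaI) (auto simp: X_def)
  qed
  also have "\<dots> = (\<Sum>\<xi>\<in>X. \<Sum>n\<in>D \<xi>. g \<xi>)"
    using fin_D by (subst sum.Sigma) (auto simp: X_def split_def)
  also have "\<dots> = (\<Sum>\<xi>\<in>X. real (card (D \<xi>)) * g \<xi>)"
    by simp
  finally show ?thesis
    by (simp add: X_def D_def)
qed

text \<open>With z = 1 + |\<xi>|/R one has |\<xi>| at most R z, so the divisor factor is O(R^\<eta>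
  z^\<eta>), and z^\<eta> is absorbed by one power of decay. This is why the decay exponent is k +
  3: the remaining k + 2 are what the summation over levels consumes.\<close>

lemma sum_divisors_fourier_coeff_le:
  fixes \<mu> :: "(real^'k) measure"
  assumes div: "\<And>m::nat. m > 0 \<Longrightarrow> real (card {d. d dvd m}) \<le> C\<^sub>d * real m powr \<eta>" and C\<^sub>d: "C\<^sub>d \<ge> 0"
    and \<eta>: "0 < \<eta>" "\<eta> \<le> 1" and s: "s \<ge> 0"
    and growth: "\<And>Q. Q \<ge> 1 \<Longrightarrow> fourier_l1_sum \<mu> Q \<le> C * Q powr (real CARD('k) - s)"
    and R: "R \<ge> 1"
  shows "(\<Sum>\<xi>\<in>int_box L - {0}. real (card {n. n dvd nat (sup_norm \<xi>)}) *
            (cmod (fourier_coeff \<mu> \<xi>) / (1 + sup_norm \<xi> / R) ^ (CARD('k) + 3)))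
       \<le> C\<^sub>d * C * (\<Sum>i. inverse ((real (Suc i))\<^sup>2)) * R powr (real CARD('k) - s + \<eta>)"
proof -
  define a where "a = (\<lambda>\<xi>::int^'k. cmod (fourier_coeff \<mu> \<xi>))"
  define k where "k = real CARD('k)"
  have term_le: "real (card {n. n dvd nat (sup_norm \<xi>)}) * (a \<xi> / (1 + sup_norm \<xi> / R) ^ (CARD('k) + 3))
      \<le> C\<^sub>d * R powr \<eta> * (a \<xi> * (1 + sup_norm \<xi> / R) powr (- (k + 2)))" if "\<xi> \<in> int_box L - {0}" for \<xi>
  proof -
    define z where "z = 1 + sup_norm \<xi> / R"
    have z: "z \<ge> 1"
      using R by (simp add: z_def)
    have "real (card {n. n dvd nat (sup_norm \<xi>)}) \<le> C\<^sub>d * real (nat (sup_norm \<xi>)) powr \<eta>"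
      using that by (intro div) (auto simp: sup_norm_pos)
    also have "\<dots> \<le> C\<^sub>d * (R * z) powr \<eta>"
      using R \<eta> C\<^sub>d by (intro mult_left_mono powr_mono2) (auto simp: z_def field_simps)
    also have "\<dots> = C\<^sub>d * R powr \<eta> * z powr \<eta>"
      using R z by (simp add: powr_mult)
    also have "\<dots> \<le> C\<^sub>d * R powr \<eta> * z powr 1"
      using z \<eta> C\<^sub>d by (intro mult_left_mono powr_mono) auto
    finally have "real (card {n. n dvd nat (sup_norm \<xi>)}) \<le> C\<^sub>d * R powr \<eta> * z powr 1" .
    then have "real (card {n. n dvd nat (sup_norm \<xi>)}) * (a \<xi> / z ^ (CARD('k) + 3))
        \<le> C\<^sub>d * R powr \<eta> * z powr 1 * (a \<xi> / z ^ (CARD('k) + 3))"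
      using z by (intro mult_right_mono) (auto simp: a_def)
    also have "\<dots> = C\<^sub>d * R powr \<eta> * (a \<xi> * (z powr 1 / z ^ (CARD('k) + 3)))"
      by simp
    also have "z powr 1 / z ^ (CARD('k) + 3) = z powr (- (k + 2))"
    proof -
      have "z ^ (CARD('k) + 3) = z powr (k + 3)"
        using z by (subst powr_realpow[symmetric]) (auto simp: k_def add_ac)
      then show ?thesis
        by (simp only: powr_diff[symmetric]) (simp add: algebra_simps)
    qed
    finally show ?thesis
      by (simp add: z_def)
  qed
  have "(\<Sum>\<xi>\<in>int_box L - {0}. real (card {n. n dvd nat (sup_norm \<xi>)}) * (a \<xi> / (1 + sup_norm \<xi> / R) ^ (CARD('k) + 3)))
     \<le> (\<Sum>\<xi>\<in>int_box L - {0}. C\<^sub>d * R powr \<eta> * (a \<xi> * (1 + sup_norm \<xi> / R) powr (- (k + 2))))"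
    by (intro sum_mono term_le)
  also have "\<dots> = C\<^sub>d * R powr \<eta> * (\<Sum>\<xi>\<in>int_box L - {0}. a \<xi> * (1 + sup_norm \<xi> / R) powr (- (k + 2)))"
    by (simp add: sum_distrib_left)
  also have "\<dots> \<le> C\<^sub>d * R powr \<eta> * (C * (\<Sum>i. inverse ((real (Suc i))\<^sup>2)) * R powr (k - s))"
  proof (intro mult_left_mono sum_weighted_by_level_le)
    fix Q :: real assume Q: "Q \<ge> 1"
    have "(\<Sum>\<xi> | \<xi> \<in> int_box L - {0} \<and> real_of_int (sup_norm \<xi>) \<le> Q. a \<xi>) \<le> fourier_l1_sum \<mu> Q"
      unfolding fourier_l1_sum_def a_def
    proof (rule sum_mono2)
      show "finite {\<xi>::int^'k. \<forall>j. real_of_int \<bar>\<xi> $ j\<bar> \<le> Q}"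
        by (simp only: freq_box_eq_int_box finite_int_box)
    qed (use sup_norm_le_iff in auto)
    with growth[OF Q] show "(\<Sum>\<xi> | \<xi> \<in> int_box L - {0} \<and> real_of_int (sup_norm \<xi>) \<le> Q. a \<xi>) \<le> C * Q powr (k - s)"
      by (simp add: k_def)
  qed (use R s C\<^sub>d in \<open>auto simp: a_def k_def\<close>)
  also have "\<dots> = C\<^sub>d * C * (\<Sum>i. inverse ((real (Suc i))\<^sup>2)) * R powr (k - s + \<eta>)"
    by (simp add: powr_add)
  finally show ?thesis
    by (simp add: a_def k_def)
qed

section \<open>Assembly of the discrepancy estimate\<close>

text \<open>Only finite partial sums are rearranged. The hypothesis \<open>bound\<close> is uniform
  in the box, so the estimate holds for every M and passes to the limit, without any absolutely
  convergent sum over all frequencies.\<close>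

lemma norm_discrepancy_sum_le:
  fixes \<mu> :: "(real^'k) measure" and dv y :: "real^'k"
  assumes w: "bump w" and \<mu>: "borel_prob_on_cube \<mu>" and N: "N \<ge> 1"
    and decay: "\<And>\<xi>. cmod (ft (\<lambda>t. of_real (w t)) \<xi>) \<le> K / (1 + \<bar>\<xi>\<bar>) ^ (CARD('k) + 3)" and K: "K \<ge> 0"
    and R: "R > 0" and T: "T \<ge> 0"
    and low: "\<And>j. 1 / R \<le> dv $ j" and up: "\<And>j. 2 * N * dv $ j \<le> T"
    and bound: "\<And>L. (\<Sum>\<xi>\<in>int_box L - {0}. real (card {n. n dvd nat (sup_norm \<xi>)}) *
            (cmod (fourier_coeff \<mu> \<xi>) / (1 + sup_norm \<xi> / R) ^ (CARD('k) + 3))) \<le> E"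
  shows "\<bar>\<Sum>n\<in>{N..<2*N}. meas_int \<mu> (A_star w dv y n) - meas_int lborel (A_star w dv y n)\<bar>
           \<le> (T * K) ^ CARD('k) * E"
proof -
  define S where "S = (\<lambda>M. \<Sum>n\<in>{N..<2*N}. \<Sum>m\<in>int_box (int M). A_coeff w dv y n m *
     (cube_coeff \<mu> (freq_scale n m) - cube_coeff lborel (freq_scale n m)))"
  have dv: "dv $ j > 0" for j
    using low[of j] R by (smt (verit) divide_pos_pos)
  have \<mu>_sets: "sets \<mu> = sets borel" and \<mu>_fin: "emeasure \<mu> unit_cube < \<infinity>"
    using \<mu> by (auto simp: borel_prob_on_cube_def)
  interpret prob_space \<mu>
    using \<mu> by (simp add: borel_prob_on_cube_def)
  have "(\<lambda>M. \<Sum>n\<in>{N..<2*N}. (\<Sum>m\<in>int_box (int M). A_coeff w dv y n m * cube_coeff \<mu> (freq_scale n m)) -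
      (\<Sum>m\<in>int_box (int M). A_coeff w dv y n m * cube_coeff lborel (freq_scale n m)))
     \<longlonglongrightarrow> (\<Sum>n\<in>{N..<2*N}. of_real (meas_int \<mu> (A_star w dv y n)) - of_real (meas_int lborel (A_star w dv y n)))"
    using N by (intro tendsto_sum tendsto_diff meas_int_A_star_fourier_series w dv \<mu>_sets \<mu>_fin)
      (auto simp: emeasure_lborel_cbox_finite)
  then have "S \<longlonglongrightarrow> of_real (\<Sum>n\<in>{N..<2*N}. meas_int \<mu> (A_star w dv y n) - meas_int lborel (A_star w dv y n))"
    by (simp add: S_def right_diff_distrib sum_subtractf)
  from tendsto_norm[OF this]
  have lim: "(\<lambda>M. cmod (S M)) \<longlonglongrightarrow> \<bar>\<Sum>n\<in>{N..<2*N}. meas_int \<mu> (A_star w dv y n) - meas_int lborel (A_star w dv y n)\<bar>"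
    by (simp only: norm_of_real)
  have "cmod (S M) \<le> (T * K) ^ CARD('k) * E" for M
  proof -
    define g where "g = (\<lambda>\<xi>::int^'k. cmod (fourier_coeff \<mu> \<xi>) / (1 + sup_norm \<xi> / R) ^ (CARD('k) + 3))"
    have g0: "g \<xi> \<ge> 0" for \<xi>
      using R by (simp add: g_def)
    have coeff_zero: "cube_coeff \<mu> (0 :: int^'k) = cube_coeff lborel 0"
      by (simp add: cube_coeff_eq_fourier_coeff[OF \<mu>] cube_coeff_lborel fourier_coeff_def prob_space)
    have inner: "cmod (\<Sum>m\<in>int_box (int M). A_coeff w dv y n m * (cube_coeff \<mu> (freq_scale n m) - cube_coeff lborel (freq_scale n m)))
        \<le> (\<Sum>m\<in>int_box (int M) - {0}. (T * K) ^ CARD('k) * g (freq_scale n m))" if n: "n \<in> {N..<2*N}" for n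
    proof -
      have "(\<Sum>m\<in>int_box (int M). A_coeff w dv y n m * (cube_coeff \<mu> (freq_scale n m) - cube_coeff lborel (freq_scale n m)))
         = (\<Sum>m\<in>int_box (int M) - {0}. A_coeff w dv y n m * (cube_coeff \<mu> (freq_scale n m) - cube_coeff lborel (freq_scale n m)))"
        by (rule sum.mono_neutral_right) (auto simp: coeff_zero)
      also have "cmod \<dots> \<le> (\<Sum>m\<in>int_box (int M) - {0}. (T * K) ^ CARD('k) * g (freq_scale n m))"
      proof (rule order.trans[OF norm_sum], rule sum_mono)
        fix m :: "int^'k" assume m: "m \<in> int_box (int M) - {0}"
        have "freq_scale n m \<noteq> 0"
          using m n N freq_scale_eq_iff[of n m 0] by auto
        then have "cmod (A_coeff w dv y n m * (cube_coeff \<mu> (freq_scale n m) - cube_coeff lborel (freq_scale n m)))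
            = cmod (A_coeff w dv y n m) * cmod (fourier_coeff \<mu> (freq_scale n m))"
          by (simp add: cube_coeff_eq_fourier_coeff[OF \<mu>] cube_coeff_lborel norm_mult)
        also have "\<dots> \<le> (T * K) ^ CARD('k) / (1 + sup_norm (freq_scale n m) / R) ^ (CARD('k) + 3)
            * cmod (fourier_coeff \<mu> (freq_scale n m))"
        proof (intro mult_right_mono norm_A_coeff_le decay K R low)
          fix j
          have "n * dv $ j \<le> 2 * N * dv $ j"
            using n dv[of j] by (intro mult_right_mono) auto
          with up[of j] show "n * dv $ j \<le> T"
            by linarith
        qed auto
        finally show "cmod (A_coeff w dv y n m * (cube_coeff \<mu> (freq_scale n m) - cube_coeff lborel (freq_scale n m)))
            \<le> (T * K) ^ CARD('k) * g (freq_scale n m)"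
          by (simp add: g_def)
      qed
      finally show ?thesis .
    qed
    have "cmod (S M) \<le> (\<Sum>n\<in>{N..<2*N}. \<Sum>m\<in>int_box (int M) - {0}. (T * K) ^ CARD('k) * g (freq_scale n m))"
      unfolding S_def by (rule order.trans[OF norm_sum], rule sum_mono, rule inner)
    also have "\<dots> = (T * K) ^ CARD('k) * (\<Sum>n\<in>{N..<2*N}. \<Sum>m\<in>int_box (int M) - {0}. g (freq_scale n m))"
      by (simp add: sum_distrib_left)
    also have "\<dots> \<le> (T * K) ^ CARD('k) * E"
    proof (intro mult_left_mono)
      have "(\<Sum>n\<in>{N..<2*N}. \<Sum>m\<in>int_box (int M) - {0}. g (freq_scale n m))
        \<le> (\<Sum>\<xi>\<in>int_box (int (2 * N * M)) - {0}. real (card {n. n dvd nat (sup_norm \<xi>)}) * g \<xi>)"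
        using g0 N by (rule sum_freq_scale_le_divisors)
      also have "\<dots> \<le> E"
        unfolding g_def by (rule bound)
      finally show "(\<Sum>n\<in>{N..<2*N}. \<Sum>m\<in>int_box (int M) - {0}. g (freq_scale n m)) \<le> E" .
    qed (use T K in auto)
    finally show ?thesis .
  qed
  then show ?thesis
    by (intro LIMSEQ_le_const2[OF lim]) auto
qed

theorem theorem3p2:
  fixes w :: "real \<Rightarrow> real"
    and \<mu> :: "(real^'k) measure"
    and \<tau> \<epsilon> \<kappa> C1 :: real
  assumes w: "bump w"
    and tau: "\<tau> > 0"
    and eps: "\<epsilon> > 0"
    and mu: "borel_prob_on_cube \<mu>"
    and kappa: "dim_l1 \<mu> = \<kappa>"
    and C1: "C1 > 0"
  shows "\<exists>C. \<forall>(N::nat) (d::real) (dv::real^'k) (y::real^'k).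
           N \<ge> 1 \<longrightarrow> 0 < d \<longrightarrow> d \<le> 1/2 \<longrightarrow>
           (\<forall>j. 0 < dv$j \<and> dv$j \<le> 1/2 \<and>
                inverse C1 * real N powr (-\<tau>) * d \<le> dv$j \<and>
                dv$j \<le> C1 * real N powr \<tau> * d) \<longrightarrow>
           \<bar>\<Sum>n\<in>{N..<2*N}. meas_int \<mu> (A_star w dv y n) - meas_int lborel (A_star w dv y n)\<bar>
             \<le> C * real N powr (real CARD('k) + (2 * real CARD('k) + \<epsilon>) * \<tau> + \<epsilon>)
                  * d powr (\<kappa> - \<epsilon>)"
proof -
  define k where "k = real CARD('k)"
  \<comment> \<open>Half of \<epsilon> goes to the divisor bound, the other half to the
    approximation of the dimension. The cap at 1 allows the divisor factor to be absorbed by a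
    single power of decay.\<close>
  define \<eta> where "\<eta> = min 1 (\<epsilon> / 2)"
  have \<eta>: "0 < \<eta>" "\<eta> \<le> 1" "\<eta> \<le> \<epsilon> / 2"
    using eps by (auto simp: \<eta>_def)
  obtain K where K: "K > 0"
    and decay: "\<And>\<xi>. cmod (ft (\<lambda>t. of_real (w t)) \<xi>) \<le> K / (1 + \<bar>\<xi>\<bar>) ^ (CARD('k) + 3)"
    using bump_ft_decay[OF w] by blast
  obtain C\<^sub>d where C\<^sub>d: "C\<^sub>d > 0"
    and div: "\<And>m::nat. m > 0 \<Longrightarrow> real (card {d. d dvd m}) \<le> C\<^sub>d * real m powr \<eta>"
    using divisor_count_bound[OF \<eta>(1)] by blast
  obtain s C\<^sub>\<mu> where s: "s \<ge> 0" "s > dim_l1 \<mu> - \<epsilon> / 2"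
    and growth: "\<And>Q. Q \<ge> 1 \<Longrightarrow> fourier_l1_sum \<mu> Q \<le> C\<^sub>\<mu> * Q powr (real CARD('k) - s)"
    using dim_l1_approx[OF mu, of "\<epsilon> / 2"] eps by auto
  have "0 \<le> fourier_l1_sum \<mu> 1"
    by (simp add: fourier_l1_sum_def sum_nonneg)
  with growth[of 1] have C\<^sub>\<mu>: "C\<^sub>\<mu> \<ge> 0"
    by simp
  define Z where "Z = (\<Sum>i. inverse ((real (Suc i))\<^sup>2))"
  have Z: "Z \<ge> 0"
    unfolding Z_def using inverse_power_summable[of 2, where 'a=real]
    by (intro suminf_nonneg, subst summable_Suc_iff) auto
  define \<sigma> where "\<sigma> = k - s + \<eta>"
  define C where "C = (2 * C1 * K) ^ CARD('k) * (C\<^sub>d * C\<^sub>\<mu> * Z * C1 powr \<sigma>)"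
  have C: "C \<ge> 0"
    using C1 K C\<^sub>d C\<^sub>\<mu> Z by (simp add: C_def)
  have main: "\<bar>\<Sum>n\<in>{N..<2*N}. meas_int \<mu> (A_star w dv y n) - meas_int lborel (A_star w dv y n)\<bar>
      \<le> C * real N powr (k + (2 * k + \<epsilon>) * \<tau> + \<epsilon>) * d powr (\<kappa> - \<epsilon>)"
    if N: "N \<ge> 1" and d: "0 < d" "d \<le> 1/2"
      and dv: "\<And>j. 0 < dv$j" "\<And>j. dv$j \<le> 1/2"
        "\<And>j. inverse C1 * real N powr (-\<tau>) * d \<le> dv$j" "\<And>j. dv$j \<le> C1 * real N powr \<tau> * d"
    for N :: nat and d and dv y :: "real^'k"
  proof -
    \<comment> \<open>1/R is exactly the assumed lower bound for the d_j, and T is 2N times the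
      upper bound.\<close>
    define R where "R = C1 * (real N powr \<tau> / d)"
    define T where "T = 2 * C1 * (real N * real N powr \<tau> * d)"
    have R0: "R > 0" and T0: "T \<ge> 0"
      using N d C1 by (auto simp: R_def T_def)
    have low: "1 / R \<le> dv $ j" for j
      using dv(3)[of j] by (simp add: R_def powr_minus field_simps)
    \<comment> \<open>R \<ge> 1 follows from the sizes of the d_j: some d_j lies between 1/R and
      1/2.\<close>
    have "1 / R \<le> 1 / 2"
      using low dv(2) by (rule order.trans)
    then have R1: "R \<ge> 1"
      using R0 by (simp add: field_simps)
    have up: "2 * real N * dv $ j \<le> T" for j
    proof -
      have "2 * real N * dv $ j \<le> 2 * real N * (C1 * real N powr \<tau> * d)"
        by (intro mult_left_mono dv(4)) auto
      then show ?thesis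
        by (simp add: T_def mult_ac)
    qed
    have "\<bar>\<Sum>n\<in>{N..<2*N}. meas_int \<mu> (A_star w dv y n) - meas_int lborel (A_star w dv y n)\<bar>
        \<le> (T * K) ^ CARD('k) * (C\<^sub>d * C\<^sub>\<mu> * Z * R powr \<sigma>)"
    proof (rule norm_discrepancy_sum_le[OF w mu N decay _ R0 T0 low up])
      show "(\<Sum>\<xi>\<in>int_box L - {0}. real (card {n. n dvd nat (sup_norm \<xi>)}) *
            (cmod (fourier_coeff \<mu> \<xi>) / (1 + sup_norm \<xi> / R) ^ (CARD('k) + 3)))
          \<le> C\<^sub>d * C\<^sub>\<mu> * Z * R powr \<sigma>" for L
        unfolding Z_def \<sigma>_def k_def
        by (rule sum_divisors_fourier_coeff_le[OF div _ \<eta>(1,2) s(1) growth R1]) (use C\<^sub>d in auto)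
    qed (use K in auto)
    also have "R powr \<sigma> = C1 powr \<sigma> * (real N powr \<tau> / d) powr \<sigma>"
      unfolding R_def by (rule powr_mult)
    also have "(T * K) ^ CARD('k) * (C\<^sub>d * C\<^sub>\<mu> * Z * (C1 powr \<sigma> * (real N powr \<tau> / d) powr \<sigma>))
        = C * ((real N * real N powr \<tau> * d) ^ CARD('k) * (real N powr \<tau> / d) powr \<sigma>)"
      by (simp add: T_def C_def power_mult_distrib)
    also have "(real N * real N powr \<tau> * d) ^ CARD('k) = real N powr (k + \<tau> * k) * d powr k"
    proof -
      have "(real N * real N powr \<tau> * d) ^ CARD('k) = (real N powr (1 + \<tau>) * d) powr k"
        using N d by (subst powr_realpow[symmetric]) (auto simp: k_def powr_add)
      also have "\<dots> = real N powr (k + \<tau> * k) * d powr k"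
        using N d by (simp add: powr_mult powr_powr algebra_simps)
      finally show ?thesis .
    qed
    also have "(real N powr \<tau> / d) powr \<sigma> = real N powr (\<tau> * \<sigma>) * d powr (- \<sigma>)"
      using N d by (simp add: powr_divide powr_powr powr_minus field_simps)
    also have "C * (real N powr (k + \<tau> * k) * d powr k * (real N powr (\<tau> * \<sigma>) * d powr (- \<sigma>)))
        = C * (real N powr (k + \<tau> * k + \<tau> * \<sigma>) * d powr (k + - \<sigma>))"
      unfolding powr_add by (simp add: mult_ac)
    \<comment> \<open>In the power of N the estimate \<open>s \<ge> 0\<close> gives k + \<sigma>
      \<le> 2k + \<epsilon>. In the power of d the exponent is k - \<sigma> = s - \<eta>, which is
      at least \<kappa> - \<epsilon>; since d < 1, lowering it can only increase the value.\<close>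
    also have "\<dots> \<le> C * (real N powr (k + (2 * k + \<epsilon>) * \<tau> + \<epsilon>) * d powr (\<kappa> - \<epsilon>))"
    proof (intro mult_left_mono mult_mono C)
      have "\<tau> * (k + \<sigma>) \<le> \<tau> * (2 * k + \<epsilon>)"
        using tau s \<eta> eps by (intro mult_left_mono) (auto simp: \<sigma>_def)
      then have "k + \<tau> * k + \<tau> * \<sigma> \<le> k + (2 * k + \<epsilon>) * \<tau> + \<epsilon>"
        using eps by (simp add: algebra_simps)
      then show "real N powr (k + \<tau> * k + \<tau> * \<sigma>) \<le> real N powr (k + (2 * k + \<epsilon>) * \<tau> + \<epsilon>)"
        using N by (intro powr_mono) auto
      show "d powr (k + - \<sigma>) \<le> d powr (\<kappa> - \<epsilon>)"
        using d s \<eta> kappa by (intro powr_mono') (auto simp: \<sigma>_def)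
    qed auto
    finally show ?thesis
      by (simp add: mult.assoc)
  qed
  show ?thesis
    using main unfolding k_def by (intro exI[of _ C] allI impI) blast
qed

end
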